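(* Let $\mathcal N$ be a monotonic max-sum $(\mathrm{Col},\delta)$-GNN with $L$ layers, dimensions $\delta_0,\dots,\delta_L$ and capacity $C_{\mathcal N}$, and let $\delta_{\mathcal N}=\max(\delta_0,\dots,\delta_L)$. Let $\Pi_{\mathcal N}$ be the Datalog program containing, up to variable renaming, every $(L,\,|\mathrm{Col}|\cdot\delta_{\mathcal N}\cdot C_{\mathcal N})$-tree-like rule (over the $(\mathrm{Col},\delta)$-signature) that is captured by $\mathcal N$. Then $\mathcal N$ and $\Pi_{\mathcal N}$ are equivalent, i.e. $T_{\mathcal N}(D)=T_{\Pi_{\mathcal N}}(D)$ for every $(\mathrm{Col},\delta)$-dataset $D$.
   Context: Datalog. Fix disjoint countably infinite sets of predicates (each with an arity), constants and variables. A term is a constant or a variable; an atom is $P(t_1,\dots,t_n)$ with $P$ of arity $n$; an inequality is $t_1\neq t_2$; a literal is an atom or an inequality; a fact is a variable-free atom; a dataset is a finite set of facts. A rule has the form $B_1\wedge\dots\wedge B_n\to H$ with $n\ge0$, literals $B_i$ and an atom $H$ (no safety condition; the empty body is written $\top$). A substitution maps finitely many variables to variable-free terms. For a rule $r$ and dataset $D$, $T_r(D)$ is the set of facts $H\nu$ for each substitution $\nu$ mapping all variables of $r$ to terms occurring in $D$ such that $B_i\nu\in D$ for each body atom and $s\neq t$ for each instantiated body inequality $s\neq t$. For a program (finite set of rules) $\Pi$, $T_\Pi(D)=\bigcup_{r\in\Pi}T_r(D)$. Two rules are equal up to variable renaming if a bijection between their variable sets maps one onto the other with exactly the same conjuncts.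 Graphs and GNNs. For a finite set of colours $\mathrm{Col}$ and $\delta\in\mathbb N$, a $(\mathrm{Col},\delta)$-graph is $G=\langle V,\{E^c\}_{c\in\mathrm{Col}},\lambda\rangle$ where $V$ is a finite vertex set, $E^c\subseteq V\times V$, and $\lambda$ assigns each vertex a vector in $\mathbb R^\delta$; it is Boolean if all feature entries are in $\{0,1\}$. A $(\mathrm{Col},\delta)$-GNN $\mathcal N$ with $L\ge 1$ layers consists of dimensions $\delta_0=\delta,\delta_1,\dots,\delta_{L-1},\delta_L=\delta$; real matrices $A_\ell$, $B_\ell^c$ of size $\delta_\ell\times\delta_{\ell-1}$ and bias vectors $b_\ell\in\mathbb R^{\delta_\ell}$ ($1\le\ell\le L$, $c\in\mathrm{Col}$); aggregation functions $\mathrm{agg}_\ell$ from finite real multisets to $\mathbb R$ (applied componentwise); an activation $\sigma:\mathbb R\to\mathbb R$ and a classification function $\mathrm{cls}:\mathbb R\to\{0,1\}$ (both componentwise). Applying $\mathcal N$ to $G$ yields labellings $\lambda_0=\lambda,\dots,\lambda_L$ with $\mathbf v_\ell=\sigma\big(A_\ell\mathbf v_{\ell-1}+\sum_{c}B_\ell^c\,\mathrm{agg}_\ell(\{\!\{\mathbf u_{\ell-1}\mid (v,u)\in E^c\}\!\})+b_\ell\big)$; $\mathcal N(G)$ has the same vertices and edges with each $v$ labelled $\mathrm{cls}(\mathbf v_L)$. Canonical transformation. The $(\mathrm{Col},\delta)$-signature consists of binary predicates $E^c$ ($c\in\mathrm{Col}$) and unary predicates $U_1,\dots,U_\delta$;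 a $(\mathrm{Col},\delta)$-dataset is a dataset over this signature. Its canonical encoding $\mathrm{enc}(D)$ has a vertex $v_t$ per term $t$ occurring in $D$, edges $(v_t,v_s)\in E^c$ iff $E^c(t,s)\in D$, and $i$-th feature of $v_t$ equal to $1$ iff $U_i(t)\in D$ (else $0$). The canonical decoding of a Boolean graph contains $E^c(t,s)$ for each edge $(v_t,v_s)\in E^c$ and $U_i(t)$ for each vertex $v_t$ with $i$-th feature $1$. $T_{\mathcal N}(D)=\mathrm{dec}(\mathcal N(\mathrm{enc}(D)))$. $\mathcal N$ captures a rule or program $\alpha$ if $T_\alpha(D)\subseteq T_{\mathcal N}(D)$ for every $(\mathrm{Col},\delta)$-dataset $D$; they are equivalent if $T_\alpha(D)=T_{\mathcal N}(D)$ for all such $D$. Max-sum aggregation and monotonic max-sum GNNs. For $k\in\mathbb N_0\cup\{\infty\}$ and finite real multiset $S$, with $m=\min(k,|S|)$, $\mathrm{maxsum}_k(S)$ is $0$ if $m=0$ and otherwise the sum of the $m$ largest elements of $S$ counted with multiplicity. A monotonic max-sum GNN is a $(\mathrm{Col},\delta)$-GNN with all entries of all $A_\ell,B_\ell^c$ nonnegative, each $\mathrm{agg}_\ell=\mathrm{maxsum}_{k_\ell}$ for some $k_\ell\in\mathbb N_0\cup\{\infty\}$, $\sigma$ monotonically increasing, unbounded and with range $\mathbb R_{\ge0}$, and $\mathrm{cls}$ a step function with some threshold $t$ ($\mathrm{cls}(t')=0$ for $t'<t$, $=1$ for $t'\ge t$). Sets $X_\ell^i$. A $(\mathrm{Col},\ell)$-multiset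 family $\mathcal Y$ assigns to each colour $c$ a finite multiset $\mathcal Y^c$ of vectors of dimension $\delta_\ell$. Let $\mathrm{Val}_\ell^i(\mathbf x,\mathcal Y)$ be the $i$-th component of $A_\ell\mathbf x+\sum_cB_\ell^c\,\mathrm{maxsum}_{k_\ell}(\mathcal Y^c)+b_\ell$. Let $X_0^i=\{0,1\}$, and for $\ell\ge1$ let $X_\ell^i$ be the set of all $\sigma(\mathrm{Val}_\ell^i(\mathbf x,\mathcal Y))$ over vectors $\mathbf x$ of dimension $\delta_{\ell-1}$ with $x_j\in X_{\ell-1}^j$ for all $j$ and $(\mathrm{Col},\ell-1)$-multiset families $\mathcal Y$ with $y_j\in X_{\ell-1}^j$ for all $c$, $\mathbf y\in\mathcal Y^c$, $j$. Capacities. Let $\alpha_L$ be the threshold of $\mathrm{cls}$. For $\ell=L,L-1,\dots,1$: let $w_\ell$ be the least nonzero entry among all entries of $A_\ell$ and all $B_\ell^c$, and $x_\ell$ the least nonzero number in $\bigcup_iX_{\ell-1}^i$. If either does not exist, set $C_\ell=\dots=C_1=0$ and stop. Otherwise let $\beta_\ell$ be the least natural number with $\sigma(\beta_\ell)\ge\alpha_\ell$, $b_\ell^{\min}$ the least entry of $b_\ell$, $C_\ell=\min(k_\ell,\lceil(\beta_\ell-b_\ell^{\min})/(w_\ell x_\ell)\rceil)$, $\alpha_{\ell-1}=(\beta_\ell-b_\ell^{\min})/w_\ell$. The capacity is $C_{\mathcal N}=\max(C_1,\dots,C_L)$. Tree-like formulas. Defined inductively: for any variable $x$, $\top$ is tree-like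 for $x$; for any unary predicate $U$, $U(x)$ is tree-like for $x$; if $\varphi_1,\varphi_2$ are tree-like for $x$ and share no variable other than $x$, then $\varphi_1\wedge\varphi_2$ is tree-like for $x$; if $E^c$ is a binary predicate and $\varphi_1,\dots,\varphi_n$ are tree-like for pairwise distinct variables $y_1,\dots,y_n$ respectively, none containing $x$ and pairwise sharing no variable, then $\bigwedge_{i=1}^n(E^c(x,y_i)\wedge\varphi_i)\wedge\bigwedge_{1\le i<j\le n}y_i\neq y_j$ is tree-like for $x$. In a tree-like formula $\varphi$, the fan-out of a variable $x$ is the number of distinct variables $y$ with $E^c(x,y)$ a conjunct of $\varphi$ for some $c$; the depth of $x$ is the maximal $n$ such that there are variables $x_0,\dots,x_n=x$ and colours with $E^{c_i}(x_{i-1},x_i)$ a conjunct for $1\le i\le n$; the depth of $\varphi$ is the maximal depth of its variables. For natural numbers $d,f$, $\varphi$ is $(d,f)$-tree-like if every variable of depth $i$ has $i\le d$ and fan-out at most $f\cdot(d-i)$. A rule is $(d,f)$-tree-like if it has the form $\varphi\to U(x)$ with $U$ unary and $\varphi$ a $(d,f)$-tree-like formula for $x$.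
   Formalization: The literal equality fails for D={E^c(a,b)}: the decoding keeps edge facts, but tree-like rules have only unary heads. What is proved is that T_N(D) equals T_{Π_N}(D) together with the binary facts of D; a negative capacity is read as 0. *)

theory Defs
  imports Complex_Main "HOL-Library.Multiset" "HOL-Library.Extended_Nat"
begin

text \<open>Constants and variables are both indexed by natural numbers (two disjoint
countably infinite sets). Unary predicate U_(i+1) is represented by index i (0-based),
so the (Col,delta)-signature has UA i for i < delta and EA c for c in Col.\<close>

datatype trm = Cst nat | Vr nat

datatype 'col atom = EA 'col trm trm | UA nat trm

datatype 'col lit = Pos "'col atom" | Neq trm trm

type_synonym 'col rule = "'col lit set \<times> 'col atom"

fun trm_vars :: "trm \<Rightarrow> nat set" where
  "trm_vars (Cst _) = {}"
| "trm_vars (Vr x) = {x}"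

fun atom_terms :: "'col atom \<Rightarrow> trm set" where
  "atom_terms (EA c s t) = {s, t}"
| "atom_terms (UA i t) = {t}"

fun lit_terms :: "'col lit \<Rightarrow> trm set" where
  "lit_terms (Pos a) = atom_terms a"
| "lit_terms (Neq s t) = {s, t}"

definition atom_vars :: "'col atom \<Rightarrow> nat set" where
  "atom_vars a = (\<Union>t\<in>atom_terms a. trm_vars t)"

definition lit_vars :: "'col lit \<Rightarrow> nat set" where
  "lit_vars l = (\<Union>t\<in>lit_terms l. trm_vars t)"

definition fvars :: "'col lit set \<Rightarrow> nat set" where
  "fvars \<phi> = (\<Union>l\<in>\<phi>. lit_vars l)"

definition rule_vars :: "'col rule \<Rightarrow> nat set" where
  "rule_vars r = fvars (fst r) \<union> atom_vars (snd r)"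

definition is_rule :: "'col rule \<Rightarrow> bool" where
  "is_rule r \<longleftrightarrow> finite (fst r)"

definition is_program :: "'col rule set \<Rightarrow> bool" where
  "is_program P \<longleftrightarrow> finite P \<and> (\<forall>r\<in>P. is_rule r)"

definition is_dataset :: "'col atom set \<Rightarrow> bool" where
  "is_dataset D \<longleftrightarrow> finite D \<and> (\<forall>a\<in>D. atom_vars a = {})"

definition sig_atom :: "'col set \<Rightarrow> nat \<Rightarrow> 'col atom \<Rightarrow> bool" where
  "sig_atom Col \<delta> a = (case a of EA c _ _ \<Rightarrow> c \<in> Col | UA i _ \<Rightarrow> i < \<delta>)"

definition sig_dataset :: "'col set \<Rightarrow> nat \<Rightarrow> 'col atom set \<Rightarrow> bool" where
  "sig_dataset Col \<delta> D \<longleftrightarrow> is_dataset D \<and> (\<forall>a\<in>D. sig_atom Col \<delta> a)"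

definition rule_sig :: "'col set \<Rightarrow> nat \<Rightarrow> 'col rule \<Rightarrow> bool" where
  "rule_sig Col \<delta> r \<longleftrightarrow>
     (\<forall>l\<in>fst r. case l of Pos a \<Rightarrow> sig_atom Col \<delta> a | Neq _ _ \<Rightarrow> True) \<and> sig_atom Col \<delta> (snd r)"

definition dconsts :: "'col atom set \<Rightarrow> nat set" where
  "dconsts D = {n. \<exists>a\<in>D. Cst n \<in> atom_terms a}"

fun sterm :: "(nat \<Rightarrow> nat) \<Rightarrow> trm \<Rightarrow> trm" where
  "sterm \<nu> (Cst n) = Cst n"
| "sterm \<nu> (Vr x) = Cst (\<nu> x)"

fun satom :: "(nat \<Rightarrow> nat) \<Rightarrow> 'col atom \<Rightarrow> 'col atom" where
  "satom \<nu> (EA c s t) = EA c (sterm \<nu> s) (sterm \<nu> t)"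
| "satom \<nu> (UA i t) = UA i (sterm \<nu> t)"

definition T_rule :: "'col rule \<Rightarrow> 'col atom set \<Rightarrow> 'col atom set" where
  "T_rule r D = {satom \<nu> (snd r) | \<nu>.
      (\<forall>x\<in>rule_vars r. \<nu> x \<in> dconsts D) \<and>
      (\<forall>a. Pos a \<in> fst r \<longrightarrow> satom \<nu> a \<in> D) \<and>
      (\<forall>s t. Neq s t \<in> fst r \<longrightarrow> sterm \<nu> s \<noteq> sterm \<nu> t)}"

definition T_prog :: "'col rule set \<Rightarrow> 'col atom set \<Rightarrow> 'col atom set" where
  "T_prog P D = (\<Union>r\<in>P. T_rule r D)"

fun rterm :: "(nat \<Rightarrow> nat) \<Rightarrow> trm \<Rightarrow> trm" where
  "rterm \<rho> (Cst n) = Cst n"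
| "rterm \<rho> (Vr x) = Vr (\<rho> x)"

fun ratom :: "(nat \<Rightarrow> nat) \<Rightarrow> 'col atom \<Rightarrow> 'col atom" where
  "ratom \<rho> (EA c s t) = EA c (rterm \<rho> s) (rterm \<rho> t)"
| "ratom \<rho> (UA i t) = UA i (rterm \<rho> t)"

fun rlit :: "(nat \<Rightarrow> nat) \<Rightarrow> 'col lit \<Rightarrow> 'col lit" where
  "rlit \<rho> (Pos a) = Pos (ratom \<rho> a)"
| "rlit \<rho> (Neq s t) = Neq (rterm \<rho> s) (rterm \<rho> t)"

definition rename_rule :: "(nat \<Rightarrow> nat) \<Rightarrow> 'col rule \<Rightarrow> 'col rule" where
  "rename_rule \<rho> r = (rlit \<rho> ` fst r, ratom \<rho> (snd r))"

definition eq_upto_renaming :: "'col rule \<Rightarrow> 'col rule \<Rightarrow> bool" where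
  "eq_upto_renaming r1 r2 \<longleftrightarrow>
     (\<exists>\<rho>. bij_betw \<rho> (rule_vars r1) (rule_vars r2) \<and> rename_rule \<rho> r1 = r2)"

definition maxsum :: "enat \<Rightarrow> real multiset \<Rightarrow> real" where
  "maxsum k S = sum_list (take (case k of enat n \<Rightarrow> n | \<infinity> \<Rightarrow> size S)
                                  (rev (sorted_list_of_multiset S)))"

text \<open>A max-sum GNN: number of layers L, dimensions delta_l, matrices A_l (rows i < delta_l,
columns j < delta_(l-1)), B_l^c, biases b_l, aggregation parameters k_l
(agg_l = maxsum k_l), activation sigma and the threshold t of the step classification
function cls (cls(v) = 1 iff v >= t). Vectors are functions nat => real, only the
components below the relevant dimension matter.\<close>
record 'col mgnn =
  layers :: nat
  dim :: "nat \<Rightarrow> nat"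
  matA :: "nat \<Rightarrow> nat \<Rightarrow> nat \<Rightarrow> real"
  matB :: "nat \<Rightarrow> 'col \<Rightarrow> nat \<Rightarrow> nat \<Rightarrow> real"
  bias :: "nat \<Rightarrow> nat \<Rightarrow> real"
  aggk :: "nat \<Rightarrow> enat"
  act :: "real \<Rightarrow> real"
  thr :: real

definition mono_maxsum_gnn :: "'col set \<Rightarrow> nat \<Rightarrow> 'col mgnn \<Rightarrow> bool" where
  "mono_maxsum_gnn Col \<delta> N \<longleftrightarrow>
     layers N \<ge> 1 \<and> dim N 0 = \<delta> \<and> dim N (layers N) = \<delta> \<and>
     (\<forall>l\<in>{1..layers N}. \<forall>i<dim N l. \<forall>j<dim N (l - 1).
         matA N l i j \<ge> 0 \<and> (\<forall>c\<in>Col. matB N l c i j \<ge> 0)) \<and>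
     mono (act N) \<and> (\<forall>M. \<exists>x. act N x > M) \<and> range (act N) = {0..}"

definition layer_val :: "'col set \<Rightarrow> 'col mgnn \<Rightarrow> nat \<Rightarrow> (nat \<Rightarrow> real)
                           \<Rightarrow> ('col \<Rightarrow> (nat \<Rightarrow> real) multiset) \<Rightarrow> nat \<Rightarrow> real" where
  "layer_val Col N l x Y i =
     (\<Sum>j<dim N (l - 1). matA N l i j * x j) +
     (\<Sum>c\<in>Col. \<Sum>j<dim N (l - 1). matB N l c i j * maxsum (aggk N l) (image_mset (\<lambda>y. y j) (Y c))) +
     bias N l i"

definition neighbours :: "'col atom set \<Rightarrow> 'col \<Rightarrow> nat \<Rightarrow> nat set" where
  "neighbours D c v = {u. EA c (Cst v) (Cst u) \<in> D}"

text \<open>Labelling lambda_l of the vertex v_t (t a constant) when applying N to enc(D).\<close>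
fun lab :: "'col set \<Rightarrow> 'col mgnn \<Rightarrow> 'col atom set \<Rightarrow> nat \<Rightarrow> nat \<Rightarrow> nat \<Rightarrow> real" where
  "lab Col N D 0 v i = (if UA i (Cst v) \<in> D then 1 else 0)"
| "lab Col N D (Suc l) v i =
     act N (layer_val Col N (Suc l) (lab Col N D l v)
              (\<lambda>c. image_mset (lab Col N D l) (mset_set (neighbours D c v))) i)"

text \<open>T_N(D) = dec(N(enc(D))).\<close>
definition T_gnn :: "'col set \<Rightarrow> nat \<Rightarrow> 'col mgnn \<Rightarrow> 'col atom set \<Rightarrow> 'col atom set" where
  "T_gnn Col \<delta> N D =
     {EA c (Cst u) (Cst v) | c u v. c \<in> Col \<and> EA c (Cst u) (Cst v) \<in> D} \<union>
     {UA i (Cst v) | i v. v \<in> dconsts D \<and> i < \<delta> \<and> thr N \<le> lab Col N D (layers N) v i}"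

definition captures :: "'col set \<Rightarrow> nat \<Rightarrow> 'col mgnn \<Rightarrow> 'col rule \<Rightarrow> bool" where
  "captures Col \<delta> N r \<longleftrightarrow> (\<forall>D. sig_dataset Col \<delta> D \<longrightarrow> T_rule r D \<subseteq> T_gnn Col \<delta> N D)"

primrec Xs :: "'col set \<Rightarrow> 'col mgnn \<Rightarrow> nat \<Rightarrow> nat \<Rightarrow> real set" where
  "Xs Col N 0 i = {0, 1}"
| "Xs Col N (Suc l) i =
     {act N (layer_val Col N (Suc l) x Y i) | x Y.
        (\<forall>j<dim N l. x j \<in> Xs Col N l j) \<and>
        (\<forall>c\<in>Col. \<forall>y\<in>#Y c. \<forall>j<dim N l. y j \<in> Xs Col N l j)}"

definition has_least_nz :: "real set \<Rightarrow> bool" where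
  "has_least_nz S \<longleftrightarrow> (\<exists>m\<in>S. m \<noteq> 0 \<and> (\<forall>y\<in>S. y \<noteq> 0 \<longrightarrow> m \<le> y))"

definition least_nz :: "real set \<Rightarrow> real" where
  "least_nz S = (LEAST m. m \<in> S \<and> m \<noteq> 0)"

definition weights :: "'col set \<Rightarrow> 'col mgnn \<Rightarrow> nat \<Rightarrow> real set" where
  "weights Col N l =
     {matA N l i j | i j. i < dim N l \<and> j < dim N (l - 1)} \<union>
     {matB N l c i j | c i j. c \<in> Col \<and> i < dim N l \<and> j < dim N (l - 1)}"

definition xset :: "'col set \<Rightarrow> 'col mgnn \<Rightarrow> nat \<Rightarrow> real set" where
  "xset Col N l = (\<Union>i<dim N (l - 1). Xs Col N (l - 1) i)"

definition beta :: "'col mgnn \<Rightarrow> real \<Rightarrow> nat" where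
  "beta N \<alpha> = (LEAST n::nat. \<alpha> \<le> act N (real n))"

definition bmin :: "'col mgnn \<Rightarrow> nat \<Rightarrow> real" where
  "bmin N l = Min {bias N l i | i. i < dim N l}"

text \<open>caps Col N l alpha_l gives C_1, ..., C_l (as a function of the layer index),
computed from layer l downwards starting with alpha_l.\<close>
primrec caps :: "'col set \<Rightarrow> 'col mgnn \<Rightarrow> nat \<Rightarrow> real \<Rightarrow> nat \<Rightarrow> nat" where
  "caps Col N 0 \<alpha> = (\<lambda>_. 0)"
| "caps Col N (Suc l) \<alpha> =
     (if has_least_nz (weights Col N (Suc l)) \<and> has_least_nz (xset Col N (Suc l)) then
        (let w = least_nz (weights Col N (Suc l));
             x = least_nz (xset Col N (Suc l));
             \<beta> = beta N \<alpha>;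
             bm = bmin N (Suc l);
             c = nat \<lceil>(real \<beta> - bm) / (w * x)\<rceil>;
             C = (case aggk N (Suc l) of enat k \<Rightarrow> min k c | \<infinity> \<Rightarrow> c)
         in (caps Col N l ((real \<beta> - bm) / w))(Suc l := C))
      else (\<lambda>_. 0))"

definition capacity :: "'col set \<Rightarrow> 'col mgnn \<Rightarrow> nat" where
  "capacity Col N = Max ((caps Col N (layers N) (thr N)) ` {1..layers N})"

definition delta_max :: "'col mgnn \<Rightarrow> nat" where
  "delta_max N = Max (dim N ` {0..layers N})"

inductive tree_like :: "'col lit set \<Rightarrow> nat \<Rightarrow> bool" where
  tl_top: "tree_like {} x"
| tl_unary: "tree_like {Pos (UA i (Vr x))} x"
| tl_conj: "\<lbrakk>tree_like \<phi>1 x; tree_like \<phi>2 x; fvars \<phi>1 \<inter> fvars \<phi>2 \<subseteq> {x}\<rbrakk>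
            \<Longrightarrow> tree_like (\<phi>1 \<union> \<phi>2) x"
| tl_edge: "\<lbrakk>distinct ys; length phis = length ys;
             \<forall>i<length ys. tree_like (phis ! i) (ys ! i);
             \<forall>i<length ys. x \<notin> fvars (phis ! i);
             \<forall>i<length ys. \<forall>j<length ys. i \<noteq> j \<longrightarrow> fvars (phis ! i) \<inter> fvars (phis ! j) = {}\<rbrakk>
            \<Longrightarrow> tree_like ((\<Union>i<length ys. insert (Pos (EA c (Vr x) (Vr (ys ! i)))) (phis ! i)) \<union>
                           {Neq (Vr (ys ! i)) (Vr (ys ! j)) | i j. i < j \<and> j < length ys}) x"

definition has_path :: "'col lit set \<Rightarrow> nat \<Rightarrow> nat \<Rightarrow> bool" where
  "has_path \<phi> n v \<longleftrightarrow> (\<exists>xs. length xs = Suc n \<and> last xs = v \<and>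
      (\<forall>i<n. \<exists>c. Pos (EA c (Vr (xs ! i)) (Vr (xs ! Suc i))) \<in> \<phi>))"

definition var_depth :: "'col lit set \<Rightarrow> nat \<Rightarrow> nat" where
  "var_depth \<phi> v = (GREATEST n. has_path \<phi> n v)"

definition fanout :: "'col lit set \<Rightarrow> nat \<Rightarrow> nat" where
  "fanout \<phi> v = card {y. \<exists>c. Pos (EA c (Vr v) (Vr y)) \<in> \<phi>}"

definition df_bounded :: "nat \<Rightarrow> nat \<Rightarrow> 'col lit set \<Rightarrow> bool" where
  "df_bounded d f \<phi> \<longleftrightarrow> (\<forall>v\<in>fvars \<phi>.
      (\<forall>n. has_path \<phi> n v \<longrightarrow> n \<le> d) \<and> fanout \<phi> v \<le> f * (d - var_depth \<phi> v))"

definition tree_like_rule :: "nat \<Rightarrow> nat \<Rightarrow> 'col rule \<Rightarrow> bool" where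
  "tree_like_rule d f r \<longleftrightarrow>
     (\<exists>\<phi> i x. r = (\<phi>, UA i (Vr x)) \<and> tree_like \<phi> x \<and> df_bounded d f \<phi>)"

definition is_PiN :: "'col set \<Rightarrow> nat \<Rightarrow> 'col mgnn \<Rightarrow> 'col rule set \<Rightarrow> bool" where
  "is_PiN Col \<delta> N P \<longleftrightarrow>
     (let d = layers N; f = card Col * delta_max N * capacity Col N in
        is_program P \<and>
        (\<forall>r\<in>P. rule_sig Col \<delta> r \<and> tree_like_rule d f r \<and> captures Col \<delta> N r) \<and>
        (\<forall>r. rule_sig Col \<delta> r \<and> tree_like_rule d f r \<and> captures Col \<delta> N r
               \<longrightarrow> (\<exists>r'\<in>P. eq_upto_renaming r r')))"

end

theory Submission
  imports Defs "HOL-Library.Countable"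
begin

text \<open>A fact \<open>U\<^sub>i(v)\<close> derived by the network on \<open>D\<close> is explained by unravelling \<open>D\<close> from \<open>v\<close>, where
  for every layer, colour and feature only as many neighbours with the largest feature values are
  kept as the capacity allows. This unravelling is a tree-like formula which matches \<open>D\<close> at \<open>v\<close>.
  It is captured: by induction on \<open>\<ell>\<close>, wherever the formula matches a dataset, each feature at layer
  \<open>\<ell>\<close> is at least the minimum of its value in \<open>D\<close> and \<open>\<alpha>\<^sub>\<ell>\<close>. Indeed, either an input of the layer
  reaches \<open>\<alpha>\<close> at the layer below, or the discarded neighbours do not matter, or so many nonzero values
  were kept that each being at least the least nonzero value \<open>x\<^sub>\<ell>\<close> suffices. The least nonzero value
  exists because the sets \<open>X\<^sub>\<ell>\<^sup>i\<close> have only finitely many elements below any bound.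

  The program is finite up to renaming because depth and fan-out bound the number of
  variables of a rule.\<close>

subsection \<open>Max-sum aggregation\<close>

text \<open>One fixed order, with ties broken by vertex number, makes the top sets for different
  \<open>k\<close> nested prefixes of one list. Nestedness matters when the truncation of the
  network is below the capacity.\<close>

definition descending :: "(nat \<Rightarrow> real) \<Rightarrow> nat set \<Rightarrow> nat list" where
  "descending f S = sort_key (\<lambda>u. - f u) (sorted_list_of_set S)"

definition top_elems :: "nat \<Rightarrow> (nat \<Rightarrow> real) \<Rightarrow> nat set \<Rightarrow> nat set" where
  "top_elems k f S = set (take k (descending f S))"

lemma set_descending: "finite S \<Longrightarrow> set (descending f S) = S"
  by (simp add: descending_def)

lemma distinct_descending: "distinct (descending f S)"
  by (simp add: descending_def)

lemma length_descending: "length (descending f S) = card S"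
  by (simp add: descending_def)

lemma top_elems_subset: "finite S \<Longrightarrow> top_elems k f S \<subseteq> S"
  unfolding top_elems_def by (metis set_descending set_take_subset)

lemma card_top_elems: "card (top_elems k f S) = min k (card S)"
  unfolding top_elems_def
  by (simp add: distinct_card distinct_descending length_descending min.commute)

lemma finite_top_elems: "finite (top_elems k f S)"
  by (simp add: top_elems_def)

lemma top_elems_ge:
  assumes "finite S" "t \<in> top_elems k f S" "s \<in> S - top_elems k f S"
  shows "f s \<le> f t"
proof -
  let ?ys = "descending f S"
  have "sorted (map (\<lambda>u. - f u) (take k ?ys @ drop k ?ys))"
    unfolding append_take_drop_id by (simp add: descending_def)
  moreover have "s \<in> set (drop k ?ys)"
    using assms(3) set_descending[OF assms(1), of f]
    by (metis Diff_iff Un_iff append_take_drop_id set_append top_elems_def)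
  ultimately show ?thesis
    using assms(2) unfolding top_elems_def map_append sorted_append by fastforce
qed

text \<open>Exchange argument: the elements of \<open>T\<close> outside the top set inject into the
  top elements outside \<open>T\<close>, and a top element dominates every element left out. By
  nonnegativity, unmatched top elements can only help.\<close>

lemma sum_le_sum_top_elems:
  assumes fin: "finite S" and sub: "T \<subseteq> S" and card: "card T \<le> k" and nn: "\<And>s. s \<in> S \<Longrightarrow> 0 \<le> f s"
  shows "sum f T \<le> sum f (top_elems k f S)"
proof -
  let ?U = "top_elems k f S"
  have finT: "finite T" using fin sub finite_subset by blast
  have US: "?U \<subseteq> S" by (rule top_elems_subset[OF fin])
  have "card T \<le> card ?U"
    using card card_mono[OF fin sub] by (simp add: card_top_elems)
  then have "card (T - ?U) \<le> card (?U - T)"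
    using finT finite_top_elems[of k f S]
    by (metis (full_types) card_le_sym_Diff)
  then obtain h where h: "h ` (T - ?U) \<subseteq> ?U - T" "inj_on h (T - ?U)"
    using card_le_inj[of "T - ?U" "?U - T"] finT finite_top_elems[of k f S] by blast
  have "sum f T = sum f (T \<inter> ?U) + sum f (T - ?U)"
    using finT by (metis add.commute sum.Int_Diff)
  also have "sum f (T - ?U) \<le> (\<Sum>u\<in>T - ?U. f (h u))"
    using h(1) sub by (intro sum_mono top_elems_ge[OF fin]) auto
  also have "\<dots> = sum f (h ` (T - ?U))"
    using h(2) by (simp add: sum.reindex)
  also have "\<dots> \<le> sum f (?U - T)"
    using h(1) US nn finite_top_elems[of k f S] by (intro sum_mono2) auto
  also have "sum f (T \<inter> ?U) + sum f (?U - T) = sum f ?U"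
    using finite_top_elems[of k f S] by (metis Int_commute sum.Int_Diff)
  finally show ?thesis by simp
qed

text \<open>Turns the multiset aggregate into a sum over concrete vertices, so that one can say
  which neighbours contribute. For \<open>\<infinity>\<close>, the cardinality of \<open>S\<close>
  serves as the number of summands.\<close>

lemma maxsum_top_elems:
  fixes f :: "nat \<Rightarrow> real"
  assumes "finite S"
  shows "maxsum k (image_mset f (mset_set S)) =
    sum f (top_elems (case k of enat n \<Rightarrow> n | \<infinity> \<Rightarrow> card S) f S)"
proof -
  let ?ys = "descending f S"
  have "sorted (rev (map f ?ys))"
  proof -
    have "sorted (map (\<lambda>u. - f u) ?ys)" by (simp add: descending_def)
    then show ?thesis
      by (simp add: sorted_wrt_rev sorted_wrt_map)
  qed
  moreover have "mset (rev (map f ?ys)) = image_mset f (mset_set S)"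
    using mset_sorted_list_of_multiset[of "mset_set S"] by (simp add: descending_def)
  ultimately have "sorted_list_of_multiset (image_mset f (mset_set S)) = rev (map f ?ys)"
    by (metis sorted_list_of_multiset_mset sorted_sort_id)
  then have eq: "maxsum k (image_mset f (mset_set S)) =
    sum_list (map f (take (case k of enat n \<Rightarrow> n | \<infinity> \<Rightarrow> card S) ?ys))"
    by (cases k) (simp_all add: maxsum_def take_map)
  have "sum_list (map f (take n ?ys)) = sum f (top_elems n f S)" for n
    unfolding top_elems_def by (simp add: sum_list_distinct_conv_sum_set distinct_descending)
  with eq show ?thesis by simp
qed

text \<open>Together with \<open>sum_le_maxsum\<close>, this describes the max-sum of nonnegative
  values as the largest sum over at most \<open>k\<close> elements, the form used in
  \<open>maxsum_le_maxsum_capped\<close>.\<close>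

lemma maxsum_attained:
  fixes f :: "nat \<Rightarrow> real"
  assumes "finite S"
  obtains T where "T \<subseteq> S" "enat (card T) \<le> k" "maxsum k (image_mset f (mset_set S)) = sum f T"
proof (rule that)
  show "top_elems (case k of enat n \<Rightarrow> n | \<infinity> \<Rightarrow> card S) f S \<subseteq> S"
    by (rule top_elems_subset[OF assms])
  show "enat (card (top_elems (case k of enat n \<Rightarrow> n | \<infinity> \<Rightarrow> card S) f S)) \<le> k"
    by (cases k) (auto simp: card_top_elems)
qed (rule maxsum_top_elems[OF assms])

lemma sum_le_maxsum:
  fixes f :: "nat \<Rightarrow> real"
  assumes "finite S" "T \<subseteq> S" "enat (card T) \<le> k" "\<And>s. s \<in> S \<Longrightarrow> 0 \<le> f s"
  shows "sum f T \<le> maxsum k (image_mset f (mset_set S))"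
  unfolding maxsum_top_elems[OF assms(1)]
proof (rule sum_le_sum_top_elems[OF assms(1,2)])
  show "card T \<le> (case k of enat n \<Rightarrow> n | \<infinity> \<Rightarrow> card S)"
    using assms(3) card_mono[OF assms(1,2)] by (cases k) auto
qed (rule assms(4))

text \<open>A coarse description, independent of \<open>k\<close>, for places where only the
  possible summands matter.\<close>

lemma maxsum_sum_list:
  "\<exists>xs. set xs \<subseteq> set_mset M \<and> maxsum k M = sum_list xs"
  unfolding maxsum_def
  by (metis order_trans set_rev set_sorted_list_of_multiset set_take_subset order_refl)

subsection \<open>Locally finite sets of nonnegative reals\<close>

text \<open>Multisets are unbounded, so the attainable values may be infinite in number. This weaker
  finiteness survives scaling, addition and summation of lists, and still yields a least nonzero
  element.\<close>

definition locally_finite_nonneg :: "real set \<Rightarrow> bool" where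
  "locally_finite_nonneg S \<longleftrightarrow> (\<forall>s\<in>S. 0 \<le> s) \<and> (\<forall>M. finite {s \<in> S. s \<le> M})"

lemma locally_finite_nonneg_finite:
  "finite S \<Longrightarrow> \<forall>s\<in>S. 0 \<le> s \<Longrightarrow> locally_finite_nonneg S"
  by (simp add: locally_finite_nonneg_def)

lemma locally_finite_nonneg_subset:
  "locally_finite_nonneg S \<Longrightarrow> T \<subseteq> S \<Longrightarrow> locally_finite_nonneg T"
  unfolding locally_finite_nonneg_def
  by (auto intro: finite_subset[of "{s \<in> T. s \<le> M}" "{s \<in> S. s \<le> M}" for M])

lemma locally_finite_nonneg_UN:
  "finite I \<Longrightarrow> (\<And>i. i \<in> I \<Longrightarrow> locally_finite_nonneg (S i)) \<Longrightarrow> locally_finite_nonneg (\<Union>i\<in>I. S i)"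
proof -
  assume "finite I" "\<And>i. i \<in> I \<Longrightarrow> locally_finite_nonneg (S i)"
  moreover have "{s \<in> (\<Union>i\<in>I. S i). s \<le> M} = (\<Union>i\<in>I. {s \<in> S i. s \<le> M})" for M by auto
  ultimately show ?thesis by (auto simp: locally_finite_nonneg_def)
qed

lemma locally_finite_nonneg_scale:
  assumes "locally_finite_nonneg S" "0 \<le> w"
  shows "locally_finite_nonneg ((*) w ` S)"
proof (cases "w = 0")
  case True
  then have "(*) w ` S \<subseteq> {0}" by auto
  then show ?thesis
    using locally_finite_nonneg_subset locally_finite_nonneg_finite[of "{0}"] by simp
next
  case False
  with assms(2) have "w > 0" by simp
  have sub: "{s \<in> (*) w ` S. s \<le> M} \<subseteq> (*) w ` {s \<in> S. s \<le> M / w}" for M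
    using \<open>w > 0\<close> by (auto simp: field_simps)
  then show ?thesis
    using assms unfolding locally_finite_nonneg_def
    by (auto intro!: finite_subset[OF sub])
qed

text \<open>By nonnegativity, a sum bounded by \<open>M\<close> has both summands bounded by
  \<open>M\<close>, which leaves finitely many pairs.\<close>

lemma locally_finite_nonneg_add:
  assumes "locally_finite_nonneg S" "locally_finite_nonneg T"
  shows "locally_finite_nonneg ((\<lambda>(s, t). s + t) ` (S \<times> T))"
proof -
  have sub: "{r \<in> (\<lambda>(s, t). s + t) ` (S \<times> T). r \<le> M} \<subseteq>
      (\<lambda>(s, t). s + t) ` ({s \<in> S. s \<le> M} \<times> {t \<in> T. t \<le> M})" for M
    using assms unfolding locally_finite_nonneg_def by (force simp: image_iff)
  then show ?thesis
    using assms unfolding locally_finite_nonneg_def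
    by (auto intro!: finite_subset[OF sub])
qed

lemma locally_finite_nonneg_sum:
  assumes "finite I" "\<And>i. i \<in> I \<Longrightarrow> locally_finite_nonneg (S i)"
  shows "locally_finite_nonneg {\<Sum>i\<in>I. f i | f. \<forall>i\<in>I. f i \<in> S i}"
  using assms
proof (induction I rule: finite_induct)
  case empty
  show ?case by (rule locally_finite_nonneg_finite) auto
next
  case (insert a I)
  have "{\<Sum>i\<in>insert a I. f i | f. \<forall>i\<in>insert a I. f i \<in> S i} \<subseteq>
      (\<lambda>(s, t). s + t) ` (S a \<times> {\<Sum>i\<in>I. f i | f. \<forall>i\<in>I. f i \<in> S i})"
    using insert(1,2) by (fastforce simp: image_iff)
  moreover have "locally_finite_nonneg (S a)"
    and "locally_finite_nonneg {\<Sum>i\<in>I. f i | f. \<forall>i\<in>I. f i \<in> S i}"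
    using insert by auto
  ultimately show ?case
    using locally_finite_nonneg_add locally_finite_nonneg_subset by blast
qed

text \<open>Once some nonzero element \<open>a\<close> is fixed, only the finitely many elements up
  to \<open>a\<close> compete for the minimum.\<close>

lemma locally_finite_nonneg_least_nz:
  assumes "locally_finite_nonneg S" "\<not> S \<subseteq> {0}"
  shows "has_least_nz S"
proof -
  obtain a where a: "a \<in> S" "a \<noteq> 0" using assms(2) by auto
  let ?F = "{s \<in> S. s \<le> a} - {0}"
  have fin: "finite ?F" and ne: "?F \<noteq> {}"
    using assms(1) a by (auto simp: locally_finite_nonneg_def)
  have "Min ?F \<in> ?F" using Min_in[OF fin ne] .
  moreover have "Min ?F \<le> y" if "y \<in> S" "y \<noteq> 0" for y
    using that fin Min_le[OF fin, of y] calculation by (cases "y \<le> a") auto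
  ultimately show ?thesis unfolding has_least_nz_def by blast
qed

lemma least_nz_props:
  assumes "has_least_nz S"
  shows "least_nz S \<in> S" "least_nz S \<noteq> 0" "y \<in> S \<Longrightarrow> y \<noteq> 0 \<Longrightarrow> least_nz S \<le> y"
proof -
  obtain m where m: "m \<in> S" "m \<noteq> 0" "\<And>y. y \<in> S \<Longrightarrow> y \<noteq> 0 \<Longrightarrow> m \<le> y"
    using assms unfolding has_least_nz_def by blast
  have "least_nz S = m" unfolding least_nz_def
    by (rule Least_equality) (use m in auto)
  with m show "least_nz S \<in> S" "least_nz S \<noteq> 0" "y \<in> S \<Longrightarrow> y \<noteq> 0 \<Longrightarrow> least_nz S \<le> y" by auto
qed

text \<open>With \<open>m\<close> the least nonzero element, a sum of at most \<open>M\<close> has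
  at most \<open>M / m\<close> nonzero summands, each at most \<open>M\<close>. Finitely many lists
  without zeros therefore produce all such sums.\<close>

lemma locally_finite_nonneg_lists:
  assumes S: "locally_finite_nonneg S"
  shows "locally_finite_nonneg {sum_list xs | xs. set xs \<subseteq> S}"
proof (cases "S \<subseteq> {0}")
  case True
  have "sum_list xs = 0" if "set xs \<subseteq> S" for xs
    using that True by (induction xs) auto
  then show ?thesis by (intro locally_finite_nonneg_finite) (auto intro: finite_subset[of _ "{0}"])
next
  case False
  define m where "m = least_nz S"
  note m = least_nz_props[OF locally_finite_nonneg_least_nz[OF S False], folded m_def]
  have m0: "m > 0" using m S unfolding locally_finite_nonneg_def by force
  have nn: "0 \<le> sum_list xs" if "set xs \<subseteq> S" for xs
    using that S by (intro sum_list_nonneg) (auto simp: locally_finite_nonneg_def)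
  have "finite {r \<in> {sum_list xs | xs. set xs \<subseteq> S}. r \<le> M}" for M
  proof -
    define n where "n = nat \<lceil>M / m\<rceil>"
    let ?L = "{xs. set xs \<subseteq> {s \<in> S. s \<le> M} \<and> length xs \<le> n}"
    have "r \<in> sum_list ` ?L" if "r = sum_list xs" "set xs \<subseteq> S" "r \<le> M" for r xs
    proof -
      let ?ys = "filter (\<lambda>x. x \<noteq> 0) xs"
      have ys: "set ?ys \<subseteq> S" using that by auto
      have r: "r = sum_list ?ys" unfolding that(1) by (induction xs) auto
      have "real (length ys) * m \<le> sum_list ys" if "set ys \<subseteq> S" "0 \<notin> set ys" for ys
        using that m(3) by (induction ys) (auto simp: algebra_simps add_mono)
      from this[OF ys] have "real (length ?ys) * m \<le> M" using r that(3) by auto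
      then have "real (length ?ys) \<le> M / m" using m0 by (simp add: field_simps)
      then have len: "length ?ys \<le> n" unfolding n_def by linarith
      have "y \<le> sum_list ys" if "set ys \<subseteq> S" "y \<in> set ys" for y ys
        using that S by (intro member_le_sum_list) (auto simp: locally_finite_nonneg_def)
      from this[OF ys] have "set ?ys \<subseteq> {s \<in> S. s \<le> M}" using ys r that(3) by force
      then show ?thesis using r len by blast
    qed
    then have "{r \<in> {sum_list xs | xs. set xs \<subseteq> S}. r \<le> M} \<subseteq> sum_list ` ?L" by blast
    moreover have "finite ?L"
      using S unfolding locally_finite_nonneg_def by (intro finite_lists_length_le) auto
    ultimately show ?thesis by (meson finite_imageI finite_subset)
  qed
  then show ?thesis using nn unfolding locally_finite_nonneg_def by auto
qed

subsection \<open>Attainable feature values\<close>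

text \<open>The bound \<open>\<alpha> \<le> Cap * x\<close> covers truncation: if all \<open>Cap\<close> retained values are at least
  \<open>x\<close>, their sum already reaches \<open>\<alpha>\<close>; if one of them vanishes, so do all the discarded ones.\<close>

lemma maxsum_le_maxsum_capped:
  fixes f f' :: "nat \<Rightarrow> real"
  assumes fin: "finite S" "finite S'"
    and K: "top_elems Cap f S \<subseteq> K" "K \<subseteq> S" "inj_on h K" "h ` K \<subseteq> S'"
    and nn: "\<And>u. u \<in> S \<Longrightarrow> 0 \<le> f u" "\<And>u. u \<in> S' \<Longrightarrow> 0 \<le> f' u"
    and dom: "\<And>u. u \<in> K \<Longrightarrow> min (f u) \<alpha> \<le> f' (h u)"
    and small: "maxsum k (image_mset f' (mset_set S')) < \<alpha>"
    and gap: "\<And>u. u \<in> S \<Longrightarrow> f u \<noteq> 0 \<Longrightarrow> x \<le> f u"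
    and cap: "k \<le> enat Cap \<or> \<alpha> \<le> real Cap * x"
  shows "maxsum k (image_mset f (mset_set S)) \<le> maxsum k (image_mset f' (mset_set S'))"
    (is "?ms \<le> ?ms'")
proof -
  let ?U = "top_elems Cap f S"
  have finK: "finite K" using K(2) fin(1) finite_subset by blast
  obtain T where T: "T \<subseteq> S" "enat (card T) \<le> k" "?ms = sum f T"
    using maxsum_attained[OF fin(1)] .
  have ms'0: "0 \<le> ?ms'"
    using sum_le_maxsum[of S' "{}" k f'] fin nn by (simp add: zero_enat_def[symmetric])
  have bound: "sum f R \<le> ?ms'" if R: "R \<subseteq> K" "enat (card R) \<le> k" for R
  proof -
    have fle: "f u \<le> f' (h u)" if u: "u \<in> R" for u
    proof -
      \<comment> \<open>A singleton is admissible in the max-sum, as \<open>R\<close> is nonempty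
        and has at most \<open>k\<close> elements. Hence \<open>f' (h u)\<close> is below \<alpha>,
        and the minimum in \<open>dom\<close> must be \<open>f u\<close>.\<close>
      have "card {h u} \<le> card R"
        using u finite_subset[OF R(1) finK] by (simp add: Suc_leI card_gt_0_iff)
           (metis One_nat_def Suc_leI card_gt_0_iff empty_iff)
      then have "enat (card {h u}) \<le> k" using R(2) by (metis enat_ord_simps(1) order_trans)
      then have "sum f' {h u} \<le> ?ms'"
        using u R(1) K(4) by (intro sum_le_maxsum[OF fin(2)] nn) auto
      then show ?thesis using dom[of u] u R(1) small by auto
    qed
    then have "sum f R \<le> (\<Sum>u\<in>R. f' (h u))" by (rule sum_mono)
    also have "\<dots> = sum f' (h ` R)"
      using inj_on_subset[OF K(3) R(1)] by (simp add: sum.reindex)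
    also have "\<dots> \<le> ?ms'"
      using R K(4) card_image[OF inj_on_subset[OF K(3) R(1)]]
      by (intro sum_le_maxsum[OF fin(2)] nn) auto
    finally show ?thesis .
  qed
  show ?thesis
  proof (cases "k \<le> enat Cap")
    case True
    then obtain n where n: "k = enat n" "n \<le> Cap" by (cases k) auto
    \<comment> \<open>The top \<open>n\<close> elements attain the max-sum and, being nested in the
      top \<open>Cap\<close>, all lie in \<open>K\<close>.\<close>
    have "sum f T \<le> sum f (top_elems n f S)"
      using T n nn by (intro sum_le_sum_top_elems[OF fin(1)]) auto
    also have "\<dots> \<le> ?ms'"
    proof (rule bound)
      have "top_elems n f S \<subseteq> ?U"
        unfolding top_elems_def using n(2) by (rule set_take_subset_set_take)
      then show "top_elems n f S \<subseteq> K" using K(1) by blast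
      show "enat (card (top_elems n f S)) \<le> k" using n by (simp add: card_top_elems)
    qed
    finally show ?thesis using T by simp
  next
    case False
    then have \<alpha>: "\<alpha> \<le> real Cap * x" and k: "enat Cap \<le> k" using cap by auto
    have Uk: "enat (card R) \<le> k" if "R \<subseteq> ?U" for R
    proof -
      have "card R \<le> card ?U" by (rule card_mono[OF finite_top_elems that])
      then have "card R \<le> Cap" by (simp add: card_top_elems)
      then show ?thesis using k by (metis enat_ord_simps(1) order_trans)
    qed
    have "\<forall>s\<in>S - ?U. f s = 0"
    proof (cases "card S \<le> Cap")
      case True
      then have "card ?U = card S" by (simp add: card_top_elems)
      then have "?U = S" by (intro card_subset_eq fin top_elems_subset)
      then show ?thesis by simp
    next
      case False
      then have cU: "card ?U = Cap" by (simp add: card_top_elems)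
      have "\<exists>u\<in>?U. f u = 0"
      proof (rule ccontr)
        assume "\<not> ?thesis"
        then have "\<And>u. u \<in> ?U \<Longrightarrow> x \<le> f u"
          using gap top_elems_subset[OF fin(1)] by blast
        then have "real Cap * x \<le> sum f ?U"
          using sum_bounded_below[of ?U x f] cU by simp
        also have "\<dots> \<le> ?ms'" by (rule bound[OF K(1) Uk]) simp
        finally show False using \<alpha> small by simp
      qed
      then show ?thesis using top_elems_ge[OF fin(1)] nn(1) by (metis Diff_iff order_antisym)
    qed
    then have "sum f T = sum f (T \<inter> ?U)"
      using T(1) fin(1) finite_subset by (intro sum.mono_neutral_right) auto
    also have "\<dots> \<le> ?ms'" using K(1) by (intro bound Uk) auto
    finally show ?thesis using T by simp
  qed
qed

section \<open>Monotonic networks and their attainable values\<close>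

locale monotonic_gnn =
  fixes Col :: "'col set" and \<delta> :: nat and N :: "'col mgnn"
  assumes finite_Col: "finite Col" and gnn: "mono_maxsum_gnn Col \<delta> N"
begin

lemma dim_0: "dim N 0 = \<delta>" and dim_layers: "dim N (layers N) = \<delta>"
  and mono_act: "mono (act N)"
  using gnn by (auto simp: mono_maxsum_gnn_def)

lemma act_nonneg: "0 \<le> act N x"
  using gnn by (auto simp: mono_maxsum_gnn_def)

lemma act_unbounded: "\<exists>x. M < act N x"
  using gnn by (auto simp: mono_maxsum_gnn_def)

lemma matA_nonneg: "Suc l \<le> layers N \<Longrightarrow> i < dim N (Suc l) \<Longrightarrow> j < dim N l \<Longrightarrow> 0 \<le> matA N (Suc l) i j"
  using gnn unfolding mono_maxsum_gnn_def by (metis One_nat_def Suc_le_mono atLeastAtMost_iff diff_Suc_1 le0)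

lemma matB_nonneg:
  "Suc l \<le> layers N \<Longrightarrow> i < dim N (Suc l) \<Longrightarrow> j < dim N l \<Longrightarrow> c \<in> Col \<Longrightarrow> 0 \<le> matB N (Suc l) c i j"
  using gnn unfolding mono_maxsum_gnn_def by (metis One_nat_def Suc_le_mono atLeastAtMost_iff diff_Suc_1 le0)

text \<open>Before the bias is added, a layer forms nonnegative combinations of values, and of sums
  of values, from the layer below, so local finiteness carries over. The activation keeps it, being
  monotone and unbounded: a bounded output forces a bounded input.\<close>

lemma locally_finite_nonneg_Xs:
  "l \<le> layers N \<Longrightarrow> i < dim N l \<Longrightarrow> locally_finite_nonneg (Xs Col N l i)"
proof (induction l arbitrary: i)
  case 0
  show ?case by (simp add: locally_finite_nonneg_finite)
next
  case (Suc l)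
  define SA where "SA = {\<Sum>j<dim N l. f j | f. \<forall>j\<in>{..<dim N l}. f j \<in> (*) (matA N (Suc l) i j) ` Xs Col N l j}"
  \<comment> \<open>Sums of arbitrary lists over-approximate the max-sum for every aggregation
    parameter.\<close>
  define sumset where "sumset j = {sum_list xs | xs. set xs \<subseteq> Xs Col N l j}" for j
  define SB where "SB c = {\<Sum>j<dim N l. f j | f. \<forall>j\<in>{..<dim N l}. f j \<in> (*) (matB N (Suc l) c i j) ` sumset j}" for c
  \<comment> \<open>The bias stays outside \<open>V\<close> because it may be negative.\<close>
  define V where "V = (\<lambda>(s, t). s + t) ` (SA \<times> {\<Sum>c\<in>Col. f c | f. \<forall>c\<in>Col. f c \<in> SB c})"
  have IH: "locally_finite_nonneg (Xs Col N l j)" if "j < dim N l" for j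
    using Suc that by simp
  have sumset: "locally_finite_nonneg (sumset j)" if "j < dim N l" for j
    unfolding sumset_def by (intro locally_finite_nonneg_lists IH that)
  have "locally_finite_nonneg SA" unfolding SA_def
    using Suc.prems by (intro locally_finite_nonneg_sum locally_finite_nonneg_scale IH matA_nonneg) auto
  moreover have "locally_finite_nonneg (SB c)" if "c \<in> Col" for c unfolding SB_def
    using Suc.prems that
    by (intro locally_finite_nonneg_sum locally_finite_nonneg_scale sumset matB_nonneg) auto
  ultimately have V: "locally_finite_nonneg V"
    unfolding V_def by (intro locally_finite_nonneg_add locally_finite_nonneg_sum finite_Col)
  have "\<exists>r\<in>V. s = act N (r + bias N (Suc l) i)" if s: "s \<in> Xs Col N (Suc l) i" for s
  proof -
    obtain x Y where xY: "s = act N (layer_val Col N (Suc l) x Y i)"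
      "\<forall>j<dim N l. x j \<in> Xs Col N l j"
      "\<forall>c\<in>Col. \<forall>y\<in>#Y c. \<forall>j<dim N l. y j \<in> Xs Col N l j"
      using s by auto
    have ms: "maxsum (aggk N (Suc l)) (image_mset (\<lambda>y. y j) (Y c)) \<in> sumset j"
      if "c \<in> Col" "j < dim N l" for c j
    proof -
      obtain xs where "set xs \<subseteq> set_mset (image_mset (\<lambda>y. y j) (Y c))"
        "maxsum (aggk N (Suc l)) (image_mset (\<lambda>y. y j) (Y c)) = sum_list xs"
        using maxsum_sum_list by blast
      moreover have "set_mset (image_mset (\<lambda>y. y j) (Y c)) \<subseteq> Xs Col N l j"
        using xY(3) that by auto
      ultimately show ?thesis unfolding sumset_def by blast
    qed
    have "(\<Sum>j<dim N l. matA N (Suc l) i j * x j) \<in> SA"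
      unfolding SA_def using xY(2) by blast
    moreover have "(\<Sum>j<dim N l. matB N (Suc l) c i j *
        maxsum (aggk N (Suc l)) (image_mset (\<lambda>y. y j) (Y c))) \<in> SB c" if "c \<in> Col" for c
      unfolding SB_def using ms[OF that] by blast
    then have "(\<Sum>c\<in>Col. \<Sum>j<dim N l. matB N (Suc l) c i j *
        maxsum (aggk N (Suc l)) (image_mset (\<lambda>y. y j) (Y c))) \<in> {\<Sum>c\<in>Col. f c | f. \<forall>c\<in>Col. f c \<in> SB c}"
      by blast
    ultimately have "layer_val Col N (Suc l) x Y i - bias N (Suc l) i \<in> V"
      unfolding V_def layer_val_def
      by (intro image_eqI[where x = "(_, _)"] SigmaI) auto
    then show ?thesis using xY(1) by (intro bexI) auto
  qed
  note repr = this
  have "finite {s \<in> Xs Col N (Suc l) i. s \<le> M}" for M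
  proof -
    obtain t where t: "M < act N t" using act_unbounded by blast
    have "{s \<in> Xs Col N (Suc l) i. s \<le> M} \<subseteq>
      (\<lambda>r. act N (r + bias N (Suc l) i)) ` {r \<in> V. r \<le> t - bias N (Suc l) i}"
    proof
      fix s assume s: "s \<in> {s \<in> Xs Col N (Suc l) i. s \<le> M}"
      then obtain r where r: "r \<in> V" "s = act N (r + bias N (Suc l) i)" using repr by blast
      have "r + bias N (Suc l) i \<le> t"
        using s r(2) t monoD[OF mono_act, of t "r + bias N (Suc l) i"] by (auto intro: ccontr)
      then show "s \<in> (\<lambda>r. act N (r + bias N (Suc l) i)) ` {r \<in> V. r \<le> t - bias N (Suc l) i}"
        using r by auto
    qed
    then show ?thesis
      using V unfolding locally_finite_nonneg_def by (meson finite_imageI finite_subset)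
  qed
  moreover have "\<forall>s\<in>Xs Col N (Suc l) i. 0 \<le> s"
    using repr act_nonneg by force
  ultimately show ?case unfolding locally_finite_nonneg_def by blast
qed

lemma locally_finite_nonneg_xset:
  "Suc l \<le> layers N \<Longrightarrow> locally_finite_nonneg (xset Col N (Suc l))"
  unfolding xset_def by (intro locally_finite_nonneg_UN locally_finite_nonneg_Xs) auto

lemma locally_finite_nonneg_weights:
  assumes "Suc l \<le> layers N"
  shows "locally_finite_nonneg (weights Col N (Suc l))"
proof (rule locally_finite_nonneg_finite)
  let ?I = "{..<dim N (Suc l)} \<times> {..<dim N l}"
  have "weights Col N (Suc l) \<subseteq> (\<lambda>(i, j). matA N (Suc l) i j) ` ?I \<union>
      (\<lambda>(c, i, j). matB N (Suc l) c i j) ` (Col \<times> ?I)"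
    unfolding weights_def by (rule Un_mono) (force simp: image_iff)+
  then show "finite (weights Col N (Suc l))"
    by (rule finite_subset) (simp add: finite_Col)
  show "\<forall>w\<in>weights Col N (Suc l). 0 \<le> w"
    using assms by (auto simp: weights_def matA_nonneg matB_nonneg)
qed

lemma lab_in_Xs: "lab Col N D l v i \<in> Xs Col N l i"
proof (induction l arbitrary: v i)
  case (Suc l)
  have "\<forall>j<dim N l. lab Col N D l v j \<in> Xs Col N l j"
    "\<forall>c\<in>Col. \<forall>y\<in>#image_mset (lab Col N D l) (mset_set (neighbours D c v)).
      \<forall>j<dim N l. y j \<in> Xs Col N l j"
    using Suc.IH by auto
  then show ?case by (simp only: lab.simps Xs.simps mem_Collect_eq) blast
qed simp

lemma lab_in_xset: "i < dim N l \<Longrightarrow> lab Col N D l v i \<in> xset Col N (Suc l)"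
  using lab_in_Xs[of D l v i] by (auto simp: xset_def)

lemma lab_nonneg: "0 \<le> lab Col N D l v i"
  by (cases l) (auto simp: act_nonneg)

text \<open>Unboundedness and monotonicity supply a natural number that qualifies, so the
  \<open>LEAST\<close> in \<open>beta\<close> is attained.\<close>

lemma beta_le: "\<alpha> \<le> act N (real (beta N \<alpha>))"
proof -
  obtain x where "\<alpha> < act N x" using act_unbounded by blast
  moreover obtain n :: nat where "x \<le> real n" using real_arch_simple by blast
  ultimately have "\<alpha> \<le> act N (real n)" using monoD[OF mono_act, of x "real n"] by linarith
  then show ?thesis unfolding beta_def by (rule LeastI)
qed

lemma bmin_le: "i < dim N l \<Longrightarrow> bmin N l \<le> bias N l i"
  unfolding bmin_def by (rule Min_le) auto

end

subsection \<open>Unravelling a dataset\<close>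

lemma finite_neighbours: "finite D \<Longrightarrow> finite (neighbours D c v)"
proof -
  assume "finite D"
  moreover have "(\<lambda>u. EA c (Cst v) (Cst u)) ` neighbours D c v \<subseteq> D"
    by (auto simp: neighbours_def)
  ultimately show ?thesis
    by (metis (mono_tags, lifting) atom.inject(1) finite_imageD finite_subset inj_onI trm.inject(1))
qed

text \<open>Set-indexed counterpart of \<open>tl_edge\<close>: children are indexed by vertices of
  the dataset, and \<open>u < u'\<close> replaces the order of positions, giving one inequality per
  pair.\<close>

definition fan :: "'col \<Rightarrow> nat \<Rightarrow> nat set \<Rightarrow> (nat \<Rightarrow> nat) \<Rightarrow> (nat \<Rightarrow> 'col lit set) \<Rightarrow> 'col lit set" where
  "fan c x S y \<phi> = (\<Union>u\<in>S. insert (Pos (EA c (Vr x) (Vr (y u)))) (\<phi> u)) \<union>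
     {Neq (Vr (y u)) (Vr (y u')) | u u'. u \<in> S \<and> u' \<in> S \<and> u < u'}"

definition sat :: "'col atom set \<Rightarrow> (nat \<Rightarrow> nat) \<Rightarrow> 'col lit set \<Rightarrow> bool" where
  "sat D \<nu> \<phi> \<longleftrightarrow> (\<forall>a. Pos a \<in> \<phi> \<longrightarrow> satom \<nu> a \<in> D) \<and>
     (\<forall>s t. Neq s t \<in> \<phi> \<longrightarrow> sterm \<nu> s \<noteq> sterm \<nu> t)"

lemma sat_Un: "sat D \<nu> (\<phi> \<union> \<psi>) \<longleftrightarrow> sat D \<nu> \<phi> \<and> sat D \<nu> \<psi>"
  by (auto simp: sat_def)

lemma sat_UN: "sat D \<nu> (\<Union>i\<in>I. \<phi> i) \<longleftrightarrow> (\<forall>i\<in>I. sat D \<nu> (\<phi> i))"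
  unfolding sat_def by blast

text \<open>The inequalities amount to injectivity on the children, which turns a match into
  distinct neighbours in the target dataset.\<close>

lemma sat_fan:
  "sat D \<nu> (fan c x S y \<phi>) \<longleftrightarrow>
     (\<forall>u\<in>S. EA c (Cst (\<nu> x)) (Cst (\<nu> (y u))) \<in> D \<and> sat D \<nu> (\<phi> u)) \<and> inj_on (\<nu> \<circ> y) S"
proof -
  have "(\<forall>u\<in>S. \<forall>u'\<in>S. u < u' \<longrightarrow> \<nu> (y u) \<noteq> \<nu> (y u')) \<longleftrightarrow> inj_on (\<nu> \<circ> y) S"
    by (auto simp: inj_on_def) (metis linorder_neqE_nat)
  moreover have "sat D \<nu> (fan c x S y \<phi>) \<longleftrightarrow>
     (\<forall>u\<in>S. EA c (Cst (\<nu> x)) (Cst (\<nu> (y u))) \<in> D \<and> sat D \<nu> (\<phi> u)) \<and>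
     (\<forall>u\<in>S. \<forall>u'\<in>S. u < u' \<longrightarrow> \<nu> (y u) \<noteq> \<nu> (y u'))"
  proof -
    have "sat D \<nu> {Neq (Vr (y u)) (Vr (y u')) | u u'. u \<in> S \<and> u' \<in> S \<and> u < u'} \<longleftrightarrow>
      (\<forall>u\<in>S. \<forall>u'\<in>S. u < u' \<longrightarrow> \<nu> (y u) \<noteq> \<nu> (y u'))"
      by (fastforce simp: sat_def)
    moreover have "sat D \<nu> (insert (Pos a) \<psi>) \<longleftrightarrow> satom \<nu> a \<in> D \<and> sat D \<nu> \<psi>" for a \<psi>
      by (auto simp: sat_def)
    ultimately show ?thesis unfolding fan_def sat_Un sat_UN by simp
  qed
  ultimately show ?thesis by simp
qed

context monotonic_gnn
begin

text \<open>The type of colours need not be countable, whereas variables are natural numbers; a code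
  injective on the finite set \<open>Col\<close> is enough.\<close>

definition colour_code :: "'col \<Rightarrow> nat" where
  "colour_code = (SOME g. inj_on g Col)"

lemma inj_on_colour_code: "inj_on colour_code Col"
proof -
  obtain g :: "'col \<Rightarrow> nat" where "inj_on g Col"
    using finite_imp_inj_to_nat_seg[OF finite_Col] by metis
  then show ?thesis unfolding colour_code_def by (rule someI[where P = "\<lambda>g. inj_on g Col"])
qed

text \<open>Features may rank the neighbours differently, so the best ones are collected separately
  for each feature, which puts the dimension into the fan-out bound.\<close>

definition selected :: "'col atom set \<Rightarrow> nat \<Rightarrow> nat \<Rightarrow> 'col \<Rightarrow> nat set" where
  "selected D l v c =
     (\<Union>j<dim N l. top_elems (capacity Col N) (\<lambda>u. lab Col N D l u j) (neighbours D c v))"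

text \<open>A variable of the unravelling encodes the path that leads to it from the root, last step
  first; a step records the layer that introduced it, its colour, and the vertex of \<open>D\<close> reached.\<close>

primrec unravel :: "'col atom set \<Rightarrow> nat \<Rightarrow> nat \<Rightarrow> (nat \<times> nat \<times> nat) list \<Rightarrow> 'col lit set" where
  "unravel D 0 v p = {Pos (UA i (Vr (to_nat p))) | i. i < \<delta> \<and> UA i (Cst v) \<in> D}"
| "unravel D (Suc l) v p = unravel D l v p \<union>
     (\<Union>c\<in>Col. fan c (to_nat p) (selected D l v c) (\<lambda>u. to_nat ((l, colour_code c, u) # p))
       (\<lambda>u. unravel D l u ((l, colour_code c, u) # p)))"

lemma selected_subset: "finite D \<Longrightarrow> selected D l v c \<subseteq> neighbours D c v"
  unfolding selected_def by (intro UN_least top_elems_subset finite_neighbours)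

lemma finite_selected: "finite (selected D l v c)"
  unfolding selected_def by (simp add: finite_top_elems)

lemma card_selected: "card (selected D l v c) \<le> dim N l * capacity Col N"
proof -
  have "card (selected D l v c) \<le> (\<Sum>j<dim N l. card (top_elems (capacity Col N)
      (\<lambda>u. lab Col N D l u j) (neighbours D c v)))"
    unfolding selected_def by (rule card_UN_le) simp
  also have "\<dots> \<le> (\<Sum>j<dim N l. capacity Col N)"
    by (intro sum_mono) (simp add: card_top_elems)
  finally show ?thesis by simp
qed

text \<open>Covers the case in which the recursion for the capacities stops. Local finiteness leaves
  two reasons for it: all weights vanish or all inputs do. Either way the layer sees only its bias,
  whatever the dataset and the vertex.\<close>

lemma lab_Suc_degenerate:
  assumes "Suc l \<le> layers N" "i < dim N (Suc l)"
    and "\<not> (has_least_nz (weights Col N (Suc l)) \<and> has_least_nz (xset Col N (Suc l)))"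
  shows "lab Col N D (Suc l) v i = act N (bias N (Suc l) i)"
proof -
  have "weights Col N (Suc l) \<subseteq> {0} \<or> xset Col N (Suc l) \<subseteq> {0}"
    using assms(1,3) locally_finite_nonneg_weights locally_finite_nonneg_xset
      locally_finite_nonneg_least_nz by blast
  then show ?thesis
  proof
    assume "weights Col N (Suc l) \<subseteq> {0}"
    then have "matA N (Suc l) i j = 0" "c \<in> Col \<Longrightarrow> matB N (Suc l) c i j = 0" if "j < dim N l" for j c
      using that assms(2) by (force simp: weights_def)+
    then show ?thesis by (simp add: layer_val_def)
  next
    assume "xset Col N (Suc l) \<subseteq> {0}"
    then have lab0: "lab Col N D l u j = 0" if "j < dim N l" for u j
      using that lab_in_xset[of j l D u] by auto
    have "maxsum k (image_mset (\<lambda>y. y j) (image_mset (lab Col N D l) M)) = 0" if j: "j < dim N l" for j k M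
    proof -
      obtain xs where xs: "set xs \<subseteq> {0}"
        "maxsum k (image_mset (\<lambda>y. y j) (image_mset (lab Col N D l) M)) = sum_list xs"
        using maxsum_sum_list[of "image_mset (\<lambda>y. y j) (image_mset (lab Col N D l) M)" k] lab0[OF j]
        by (auto simp: subset_iff image_iff)
      have "sum_list xs = 0" using xs(1) by (induction xs) auto
      then show ?thesis using xs(2) by simp
    qed
    then show ?thesis using lab0 by (simp add: layer_val_def del: image_mset.comp multiset.map_comp)
  qed
qed

text \<open>The threshold \<alpha> must vary in the induction because \<open>caps\<close> passes a
  new one to the layer below. The cut-off at \<alpha> accounts for discarded neighbours:
  \<open>D'\<close> need not reproduce values beyond it.\<close>

lemma lab_unravel_le:
  assumes fin: "finite D" "finite D'"
  shows "l \<le> layers N \<Longrightarrow> \<forall>m\<in>{1..l}. caps Col N l \<alpha> m \<le> capacity Col N \<Longrightarrow>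
    sat D' \<nu> (unravel D l v p) \<Longrightarrow> i < dim N l \<Longrightarrow>
    min (lab Col N D l v i) \<alpha> \<le> lab Col N D' l (\<nu> (to_nat p)) i"
proof (induction l arbitrary: \<alpha> v p i)
  case 0
  then show ?case by (auto simp: sat_def dim_0)
next
  case (Suc l)
  let ?Cap = "capacity Col N"
  show ?case
  proof (cases "has_least_nz (weights Col N (Suc l)) \<and> has_least_nz (xset Col N (Suc l))")
    case False
    then show ?thesis using lab_Suc_degenerate[OF Suc.prems(1,4) False] by simp
  next
    case True
    define w where "w = least_nz (weights Col N (Suc l))"
    define x where "x = least_nz (xset Col N (Suc l))"
    define \<beta> where "\<beta> = beta N \<alpha>"
    define bm where "bm = bmin N (Suc l)"
    define \<alpha>' where "\<alpha>' = (real \<beta> - bm) / w"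
    let ?k = "aggk N (Suc l)"
    note w = least_nz_props[OF conjunct1[OF True], folded w_def]
    note x = least_nz_props[OF conjunct2[OF True], folded x_def]
    have w0: "0 < w" using w(1,2) locally_finite_nonneg_weights[OF Suc.prems(1)]
      by (force simp: locally_finite_nonneg_def)
    have x0: "0 < x" using x(1,2) locally_finite_nonneg_xset[OF Suc.prems(1)]
      by (force simp: locally_finite_nonneg_def)
    define c0 where "c0 = nat \<lceil>(real \<beta> - bm) / (w * x)\<rceil>"
    have caps: "caps Col N (Suc l) \<alpha> = (caps Col N l \<alpha>')(Suc l := case ?k of enat k \<Rightarrow> min k c0 | \<infinity> \<Rightarrow> c0)"
      using True unfolding w_def x_def \<beta>_def bm_def \<alpha>'_def c0_def by (simp add: Let_def)
    have caps': "\<forall>m\<in>{1..l}. caps Col N l \<alpha>' m \<le> ?Cap"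
    proof
      fix m assume "m \<in> {1..l}"
      then show "caps Col N l \<alpha>' m \<le> ?Cap"
        using Suc.prems(2)[unfolded caps] by (auto dest!: bspec[of _ _ m])
    qed
    \<comment> \<open>The capacity of the layer is the minimum of the aggregation parameter and
      \<open>c0\<close>, so bounding it bounds one of the two. This yields the disjunction
      \<open>cap\<close> needed for comparing max-sums.\<close>
    have "(case ?k of enat k \<Rightarrow> min k c0 | \<infinity> \<Rightarrow> c0) \<le> ?Cap"
      using Suc.prems(2)[unfolded caps] by (auto dest!: bspec[of _ _ "Suc l"])
    then have "?k \<le> enat ?Cap \<or> c0 \<le> ?Cap" by (cases ?k) auto
    moreover have "\<alpha>' \<le> real ?Cap * x" if "c0 \<le> ?Cap"
    proof -
      have "(real \<beta> - bm) / (w * x) \<le> real ?Cap" using that unfolding c0_def by linarith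
      then show ?thesis using w0 x0 unfolding \<alpha>'_def by (simp add: field_simps)
    qed
    ultimately have cap: "?k \<le> enat ?Cap \<or> \<alpha>' \<le> real ?Cap * x" by blast
    let ?y = "\<lambda>c u. to_nat ((l, colour_code c, u) # p)"
    let ?v' = "\<nu> (to_nat p)"
    \<comment> \<open>\<open>matA\<close> reads the same vertex one layer lower, which the first
      conjunct controls; \<open>matB\<close> reads the neighbours, which the fans control.\<close>
    have sat0: "sat D' \<nu> (unravel D l v p)"
      and fans: "\<And>c. c \<in> Col \<Longrightarrow> sat D' \<nu> (fan c (to_nat p) (selected D l v c) (?y c)
        (\<lambda>u. unravel D l u ((l, colour_code c, u) # p)))"
      using Suc.prems(3) by (auto simp: sat_Un sat_UN)
    let ?a = "\<lambda>D v j. matA N (Suc l) i j * lab Col N D l v j"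
    let ?ms = "\<lambda>D v c j. maxsum ?k (image_mset (\<lambda>u. lab Col N D l u j) (mset_set (neighbours D c v)))"
    let ?b = "\<lambda>D v c j. matB N (Suc l) c i j * ?ms D v c j"
    let ?val = "\<lambda>D v. (\<Sum>j<dim N l. ?a D v j) + (\<Sum>c\<in>Col. \<Sum>j<dim N l. ?b D v c j) + bias N (Suc l) i"
    have lab_Suc: "lab Col N D (Suc l) v i = act N (?val D v)" for D v
      by (simp add: layer_val_def multiset.map_comp comp_def)
    have ms0: "0 \<le> ?ms D v c j" if "finite D" for D v c j
      using sum_le_maxsum[OF finite_neighbours[OF that], of "{}" c v ?k] lab_nonneg
      by (simp add: zero_enat_def[symmetric])
    have a0: "0 \<le> ?a D v j" if "j < dim N l" for D v j
      using that Suc.prems(1,4) by (simp add: matA_nonneg lab_nonneg)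
    have b0: "0 \<le> ?b D' v c j" if "c \<in> Col" "j < dim N l" for v c j
      using that Suc.prems(1,4) by (simp add: matB_nonneg ms0 fin)
    \<comment> \<open>If the value over \<open>D'\<close> reaches \<beta>, its activation reaches
      \<alpha> and nothing is left to prove. Otherwise even every single term over \<open>D'\<close>
      dominates the corresponding term over \<open>D\<close>.\<close>
    have "?val D v \<le> ?val D' ?v'" if small: "?val D' ?v' < real \<beta>"
    proof -
      have sumA0: "0 \<le> (\<Sum>j<dim N l. ?a D' ?v' j)" using a0 by (intro sum_nonneg) auto
      have sumB0: "0 \<le> (\<Sum>c\<in>Col. \<Sum>j<dim N l. ?b D' ?v' c j)" using b0 by (intro sum_nonneg) auto
      have bm: "bm \<le> bias N (Suc l) i" unfolding bm_def by (rule bmin_le[OF Suc.prems(4)])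
      \<comment> \<open>The other terms are nonnegative, so a single term stays below
        \<open>\<beta> - bm\<close>. Its weight is at least \<open>w\<close>, so its input lies
        below the threshold \<open>\<alpha>'\<close> of the lower layer, where the minimum in the
        induction hypothesis is no longer cut off.\<close>
      have lt_alpha: "z < \<alpha>'" if "q \<in> weights Col N (Suc l)" "q \<noteq> 0" "0 \<le> z" "q * z < real \<beta> - bm" for q z
      proof -
        have "w * z \<le> q * z" using w(3)[OF that(1,2)] that(3) by (rule mult_right_mono)
        then show ?thesis using that(4) w0 unfolding \<alpha>'_def by (simp add: field_simps)
      qed
      have "?a D v j \<le> ?a D' ?v' j" if j: "j < dim N l" for j
      proof (cases "matA N (Suc l) i j = 0")
        case False
        have "?a D' ?v' j \<le> (\<Sum>j<dim N l. ?a D' ?v' j)"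
          using a0 j by (intro member_le_sum) auto
        then have "?a D' ?v' j < real \<beta> - bm" using small sumB0 bm by linarith
        then have "lab Col N D' l ?v' j < \<alpha>'"
          using False j Suc.prems(4) by (intro lt_alpha[of "matA N (Suc l) i j"] lab_nonneg)
            (auto simp: weights_def)
        moreover have "min (lab Col N D l v j) \<alpha>' \<le> lab Col N D' l ?v' j"
          using Suc.prems(1) j by (intro Suc.IH caps' sat0) auto
        ultimately show ?thesis
          using matA_nonneg[OF Suc.prems(1,4) j] by (intro mult_left_mono) auto
      qed simp
      moreover have "?b D v c j \<le> ?b D' ?v' c j" if c: "c \<in> Col" and j: "j < dim N l" for c j
      proof (cases "matB N (Suc l) c i j = 0")
        case False
        have "?b D' ?v' c j \<le> (\<Sum>j<dim N l. ?b D' ?v' c j)"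
          using b0 c j by (intro member_le_sum) auto
        also have "\<dots> \<le> (\<Sum>c\<in>Col. \<Sum>j<dim N l. ?b D' ?v' c j)"
          using b0 c finite_Col by (intro member_le_sum[where f = "\<lambda>c. \<Sum>j<dim N l. ?b D' ?v' c j"] sum_nonneg) auto
        finally have "?b D' ?v' c j < real \<beta> - bm" using small sumA0 bm by linarith
        then have ms_small: "?ms D' ?v' c j < \<alpha>'"
          using False c j Suc.prems(4) by (intro lt_alpha[of "matB N (Suc l) c i j"] ms0 fin)
            (auto simp: weights_def)
        have "?ms D v c j \<le> ?ms D' ?v' c j"
        proof (rule maxsum_le_maxsum_capped)
          show "top_elems ?Cap (\<lambda>u. lab Col N D l u j) (neighbours D c v) \<subseteq> selected D l v c"
            using j by (auto simp: selected_def)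
          show "selected D l v c \<subseteq> neighbours D c v" by (rule selected_subset[OF fin(1)])
          show "inj_on (\<nu> \<circ> ?y c) (selected D l v c)"
            using fans[OF c] by (simp add: sat_fan)
          show "(\<nu> \<circ> ?y c) ` selected D l v c \<subseteq> neighbours D' c ?v'"
            using fans[OF c] by (auto simp: sat_fan neighbours_def)
          show "min (lab Col N D l u j) \<alpha>' \<le> lab Col N D' l ((\<nu> \<circ> ?y c) u) j" if "u \<in> selected D l v c" for u
          proof -
            have "sat D' \<nu> (unravel D l u ((l, colour_code c, u) # p))"
              using fans[OF c] that by (simp add: sat_fan)
            then show ?thesis using Suc.IH[OF _ caps' _ j] Suc.prems(1) by simp
          qed
          show "x \<le> lab Col N D l u j" if "lab Col N D l u j \<noteq> 0" for u
            using that x(3) lab_in_xset[OF j] by blast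
        qed (use fin finite_neighbours lab_nonneg ms_small cap in auto)
        then show ?thesis
          using matB_nonneg[OF Suc.prems(1,4) j c] by (rule mult_left_mono)
      qed simp
      ultimately show ?thesis by (intro add_mono sum_mono order_refl) auto
    qed
    then have "?val D v \<le> ?val D' ?v' \<or> real \<beta> \<le> ?val D' ?v'" by linarith
    moreover have "min (act N V) \<alpha> \<le> act N V'" if "V \<le> V' \<or> real \<beta> \<le> V'" for V V'
      using that monoD[OF mono_act, of V V'] monoD[OF mono_act, of "real \<beta>" V'] beta_le[of \<alpha>]
      unfolding \<beta>_def by linarith
    ultimately show ?thesis unfolding lab_Suc by blast
  qed
qed

end

subsection \<open>Shape of the unravelling\<close>

lemma fvars_empty [simp]: "fvars {} = {}"
  and fvars_Un: "fvars (\<phi> \<union> \<psi>) = fvars \<phi> \<union> fvars \<psi>"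
  and fvars_UN: "fvars (\<Union>i\<in>I. \<Phi> i) = (\<Union>i\<in>I. fvars (\<Phi> i))"
  and fvars_insert: "fvars (insert a \<phi>) = lit_vars a \<union> fvars \<phi>"
  by (auto simp: fvars_def)

lemma lit_vars_simps [simp]:
  "lit_vars (Pos a) = atom_vars a" "lit_vars (Neq s t) = trm_vars s \<union> trm_vars t"
  "atom_vars (EA c s t) = trm_vars s \<union> trm_vars t" "atom_vars (UA i t) = trm_vars t"
  by (auto simp: lit_vars_def atom_vars_def)

lemma fvars_fan:
  "fvars (fan c x S y \<phi>) \<subseteq> insert x (\<Union>u\<in>S. insert (y u) (fvars (\<phi> u)))"
  unfolding fan_def fvars_Un fvars_UN fvars_insert by (auto simp: fvars_def)

lemma tree_like_UN:
  assumes "finite I" "\<And>i. i \<in> I \<Longrightarrow> tree_like (\<phi> i) x"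
    and "\<And>i j. i \<in> I \<Longrightarrow> j \<in> I \<Longrightarrow> i \<noteq> j \<Longrightarrow> fvars (\<phi> i) \<inter> fvars (\<phi> j) \<subseteq> {x}"
  shows "tree_like (\<Union>i\<in>I. \<phi> i) x"
  using assms
proof (induction I rule: finite_induct)
  case empty
  show ?case by (simp add: tl_top)
next
  case (insert a I)
  have "fvars (\<phi> a) \<inter> fvars (\<Union>i\<in>I. \<phi> i) \<subseteq> {x}"
  proof
    fix z assume "z \<in> fvars (\<phi> a) \<inter> fvars (\<Union>i\<in>I. \<phi> i)"
    then obtain i where "i \<in> I" "z \<in> fvars (\<phi> a) \<inter> fvars (\<phi> i)" by (auto simp: fvars_UN)
    then show "z \<in> {x}" using insert.prems(2)[of a i] insert.hyps(2) by blast
  qed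
  then have "tree_like (\<phi> a \<union> (\<Union>i\<in>I. \<phi> i)) x"
    using insert.prems by (intro tl_conj insert.IH) auto
  then show ?case by simp
qed

text \<open>Listing \<open>S\<close> increasingly identifies \<open>u < u'\<close> with the order of
  positions demanded by \<open>tl_edge\<close>.\<close>

lemma tree_like_fan:
  fixes \<phi> :: "nat \<Rightarrow> 'col lit set"
  assumes "finite S" "inj_on y S" "\<And>u. u \<in> S \<Longrightarrow> tree_like (\<phi> u) (y u)"
    and "\<And>u. u \<in> S \<Longrightarrow> x \<notin> fvars (\<phi> u)"
    and "\<And>u u'. u \<in> S \<Longrightarrow> u' \<in> S \<Longrightarrow> u \<noteq> u' \<Longrightarrow> fvars (\<phi> u) \<inter> fvars (\<phi> u') = {}"
  shows "tree_like (fan c x S y \<phi>) x"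
proof -
  define us where "us = sorted_list_of_set S"
  have us: "set us = S" "distinct us" "sorted_wrt (<) us" using assms(1) by (auto simp: us_def)
  have nth: "us ! i \<in> S" if "i < length us" for i using us(1) that nth_mem by blast
  have disj: "fvars (\<phi> (us ! i)) \<inter> fvars (\<phi> (us ! j)) = {}"
    if "i < length us" "j < length us" "i \<noteq> j" for i j
    using that nth us(2) by (intro assms(5)) (auto simp: nth_eq_iff_index_eq)
  have S: "S = (\<lambda>i. us ! i) ` {..<length us}"
    using us(1) by (auto simp: set_conv_nth)
  have "tree_like ((\<Union>i<length (map y us). insert (Pos (EA c (Vr x) (Vr (map y us ! i)))) (map \<phi> us ! i)) \<union>
      {Neq (Vr (map y us ! i)) (Vr (map y us ! j)) | i j. i < j \<and> j < length (map y us)}) x"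
    using us assms(2) nth assms(3,4) disj
    by (intro tl_edge) (simp_all add: distinct_map)
  moreover have "(\<Union>i<length (map y us). insert (Pos (EA c (Vr x) (Vr (map y us ! i)))) (map \<phi> us ! i)) =
      (\<Union>u\<in>S. insert (Pos (EA c (Vr x) (Vr (y u)))) (\<phi> u))"
    by (subst S) auto
  moreover have "{Neq (Vr (map y us ! i)) (Vr (map y us ! j)) | i j. i < j \<and> j < length (map y us)} =
      ({Neq (Vr (y u)) (Vr (y u')) | u u'. u \<in> S \<and> u' \<in> S \<and> u < u'} :: 'col lit set)" (is "?A = ?B")
  proof
    show "?A \<subseteq> ?B"
    proof
      fix a assume "a \<in> ?A"
      then obtain i j where "a = Neq (Vr (y (us ! i))) (Vr (y (us ! j)))" "i < j" "j < length us"
        by auto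
      moreover from this have "us ! i \<in> S" "us ! j \<in> S" "us ! i < us ! j"
        using nth sorted_wrt_nth_less[OF us(3), of i j] by auto
      ultimately show "a \<in> ?B" by blast
    qed
    show "?B \<subseteq> ?A"
    proof
      fix a assume "a \<in> ?B"
      then obtain u u' where a: "a = Neq (Vr (y u)) (Vr (y u'))" "u \<in> S" "u' \<in> S" "u < u'"
        by auto
      then obtain i j where ij: "u = us ! i" "u' = us ! j" "i < length us" "j < length us"
        using S by auto
      have "i < j"
        using ij a(4) sorted_wrt_nth_less[OF us(3), of j i] by (metis linorder_neqE_nat order_less_asym order_less_irrefl)
      moreover have "a = Neq (Vr (map y us ! i)) (Vr (map y us ! j))" "j < length (map y us)"
        using a(1) ij by simp_all
      ultimately show "a \<in> ?A" by blast
    qed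
  qed
  ultimately show ?thesis unfolding fan_def by (simp only:)
qed

text \<open>Paths grow at the head, so the subtree hanging at \<open>p\<close> consists of the lists
  with suffix \<open>p\<close>.\<close>

definition below :: "(nat \<times> nat \<times> nat) list \<Rightarrow> nat set" where
  "below p = {to_nat (r @ p) | r. True}"

lemma to_nat_in_below [simp]: "to_nat p \<in> below p"
  unfolding below_def by (metis (mono_tags) append_Nil mem_Collect_eq)

lemma below_Cons_subset: "below (e # p) \<subseteq> below p"
proof
  fix z assume "z \<in> below (e # p)"
  then obtain r where "z = to_nat ((r @ [e]) @ p)" by (auto simp: below_def)
  then show "z \<in> below p" unfolding below_def by blast
qed

lemma below_disjoint: "e \<noteq> e' \<Longrightarrow> below (e # p) \<inter> below (e' # p) = {}"
proof -
  assume "e \<noteq> e'"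
  have "r @ e # p \<noteq> r' @ e' # p" for r r'
  proof
    assume "r @ e # p = r' @ e' # p"
    then have "(r @ [e]) @ p = (r' @ [e']) @ p" by simp
    then show False using \<open>e \<noteq> e'\<close> by simp
  qed
  then show ?thesis by (auto simp: below_def)
qed

lemma to_nat_notin_below_Cons: "to_nat p \<notin> below (e # p)"
proof
  assume "to_nat p \<in> below (e # p)"
  then obtain r where "p = r @ e # p" by (auto simp: below_def)
  then have "length p = length (r @ e # p)" by (rule arg_cong)
  then show False by simp
qed

context monotonic_gnn
begin

text \<open>This is why steps record layers: a formula for layer \<open>l\<close> continues
  \<open>p\<close> only by steps of smaller layers, so it shares nothing but \<open>p\<close> with
  the fans added at \<open>Suc l\<close>, whose first steps carry \<open>l\<close>.\<close>

lemma fvars_unravel: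
  "fvars (unravel D l v p) \<subseteq> insert (to_nat p) (\<Union>e\<in>{e. fst e < l}. below (e # p))"
proof (induction l arbitrary: v p)
  case 0
  show ?case by (auto simp: fvars_def)
next
  case (Suc l)
  have sub: "insert (to_nat q) (fvars (unravel D l u q)) \<subseteq> below q" for u q
    using Suc.IH[of u q] below_Cons_subset[of _ q] by fastforce
  have "fvars (fan c (to_nat p) (selected D l v c) (\<lambda>u. to_nat ((l, colour_code c, u) # p))
       (\<lambda>u. unravel D l u ((l, colour_code c, u) # p))) \<subseteq>
     insert (to_nat p) (\<Union>e\<in>{e. fst e < Suc l}. below (e # p))" for c
  proof (rule order_trans[OF fvars_fan])
    let ?e = "\<lambda>u. (l, colour_code c, u)"
    have "insert (to_nat (?e u # p)) (fvars (unravel D l u (?e u # p))) \<subseteq>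
        (\<Union>e\<in>{e. fst e < Suc l}. below (e # p))" for u
      by (rule order_trans[OF sub], rule UN_upper) simp
    then show "insert (to_nat p) (\<Union>u\<in>selected D l v c. insert (to_nat (?e u # p))
        (fvars (unravel D l u (?e u # p)))) \<subseteq> insert (to_nat p) (\<Union>e\<in>{e. fst e < Suc l}. below (e # p))"
      by blast
  qed
  moreover have "fvars (unravel D l v p) \<subseteq> insert (to_nat p) (\<Union>e\<in>{e. fst e < Suc l}. below (e # p))"
    using Suc.IH[of v p] by fastforce
  ultimately show ?case unfolding unravel.simps fvars_Un fvars_UN by blast
qed

lemma fvars_unravel_below: "fvars (unravel D l v p) \<subseteq> below p"
  using fvars_unravel[of D l v p] below_Cons_subset[of _ p] by fastforce

text \<open>Disjointness has three sources: children in one fan differ in the vertex, fans of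
  different colours in the colour code, and the fans differ from the lower-layer formula in the
  layer number.\<close>

lemma tree_like_unravel: "tree_like (unravel D l v p) (to_nat p)"
proof (induction l arbitrary: v p)
  case 0
  have "tree_like (\<Union>i\<in>{i. i < \<delta> \<and> UA i (Cst v) \<in> D}. {Pos (UA i (Vr (to_nat p)))}) (to_nat p)"
    by (rule tree_like_UN) (auto intro: tl_unary simp: fvars_def)
  moreover have "unravel D 0 v p = (\<Union>i\<in>{i. i < \<delta> \<and> UA i (Cst v) \<in> D}. {Pos (UA i (Vr (to_nat p)))})"
    by auto
  ultimately show ?case by simp
next
  case (Suc l)
  let ?e = "\<lambda>c u. (l, colour_code c, u)"
  let ?F = "\<lambda>c. fan c (to_nat p) (selected D l v c) (\<lambda>u. to_nat (?e c u # p)) (\<lambda>u. unravel D l u (?e c u # p))"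
  have fan: "tree_like (?F c) (to_nat p)" for c
  proof (rule tree_like_fan[OF finite_selected])
    show "inj_on (\<lambda>u. to_nat (?e c u # p)) (selected D l v c)" by (auto simp: inj_on_def)
    show "to_nat p \<notin> fvars (unravel D l u (?e c u # p))" for u
      using fvars_unravel_below to_nat_notin_below_Cons by blast
    show "fvars (unravel D l u (?e c u # p)) \<inter> fvars (unravel D l u' (?e c u' # p)) = {}"
      if "u \<noteq> u'" for u u'
      using fvars_unravel_below[of D l _ "_ # p"] below_disjoint[of "?e c u" "?e c u'" p] that by blast
  qed (rule Suc.IH)
  have fvF: "fvars (?F c) \<subseteq> insert (to_nat p) (\<Union>u. below (?e c u # p))" for c
    using fvars_unravel_below to_nat_in_below by (intro order_trans[OF fvars_fan]) fast
  have "tree_like (\<Union>c\<in>Col. ?F c) (to_nat p)"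
  proof (rule tree_like_UN[OF finite_Col fan])
    fix c c' assume "c \<in> Col" "c' \<in> Col" "c \<noteq> c'"
    then have "colour_code c \<noteq> colour_code c'"
      using inj_on_colour_code by (auto simp: inj_on_def)
    then have "below (?e c u # p) \<inter> below (?e c' u' # p) = {}" for u u'
      by (intro below_disjoint) auto
    then show "fvars (?F c) \<inter> fvars (?F c') \<subseteq> {to_nat p}"
      using fvF[of c] fvF[of c'] by blast
  qed
  moreover have "fvars (unravel D l v p) \<inter> fvars (\<Union>c\<in>Col. ?F c) \<subseteq> {to_nat p}"
  proof -
    have "below (e # p) \<inter> below (?e c u # p) = {}" if "fst e < l" for e c u
      using that by (intro below_disjoint) auto
    then show ?thesis
      using fvars_unravel[of D l v p] fvF unfolding fvars_UN by blast
  qed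
  ultimately show ?case unfolding unravel.simps by (intro tl_conj Suc.IH)
qed

text \<open>Each edge prolongs a path \<open>q\<close> by one step, at the root or deeper. Layers
  strictly decrease along a path, so its length plus its current layer never increases; this later
  bounds both depth and fan-out.\<close>

lemma edge_unravel:
  "Pos (EA c s t) \<in> unravel D l v p \<Longrightarrow> c \<in> Col \<and> (\<exists>q m u.
     s = Vr (to_nat q) \<and> t = Vr (to_nat ((m, colour_code c, u) # q)) \<and>
     (q = p \<and> m < l \<and> u \<in> selected D m v c \<or>
      (\<exists>e q'. q = e # q' \<and> m < fst e \<and> u \<in> selected D m (snd (snd e)) c \<and>
              length q + fst e \<le> length p + l)))"
proof (induction l arbitrary: v p)
  case 0
  then show ?case by simp
next
  case (Suc l)
  from Suc.prems consider "Pos (EA c s t) \<in> unravel D l v p"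
    | "c \<in> Col" "\<exists>u\<in>selected D l v c. s = Vr (to_nat p) \<and> t = Vr (to_nat ((l, colour_code c, u) # p))"
    | c' u where "Pos (EA c s t) \<in> unravel D l u ((l, colour_code c', u) # p)"
    unfolding unravel.simps fan_def by auto
  then show ?case
  proof cases
    case 1
    from Suc.IH[OF this] show ?thesis by (elim conjE exE disjE) fastforce+
  next
    case 2
    then show ?thesis by blast
  next
    case 3
    from Suc.IH[OF this] show ?thesis by fastforce
  qed
qed

text \<open>The layer whose formula is attached at \<open>q\<close>; the root starts with all of
  them.\<close>

definition path_level :: "(nat \<times> nat \<times> nat) list \<Rightarrow> nat" where
  "path_level q = (case q of [] \<Rightarrow> layers N | e # _ \<Rightarrow> fst e)"

definition path_end :: "nat \<Rightarrow> (nat \<times> nat \<times> nat) list \<Rightarrow> nat" where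
  "path_end v q = (case q of [] \<Rightarrow> v | e # _ \<Rightarrow> snd (snd e))"

lemma edge_unravel_root:
  assumes "Pos (EA c s t) \<in> unravel D (layers N) v []"
  obtains q m u where "c \<in> Col" "s = Vr (to_nat q)" "t = Vr (to_nat ((m, colour_code c, u) # q))"
    "m < path_level q" "u \<in> selected D m (path_end v q) c" "length q + path_level q \<le> layers N"
  using edge_unravel[OF assms] by (fastforce simp: path_level_def path_end_def)

text \<open>Each edge lengthens the encoded path by one, but a path in the formula may start below
  the root, so only an inequality holds. For the depth bound, the source of the last edge still has
  positive level, which leaves room for one more step.\<close>

lemma has_path_unravel:
  assumes "has_path (unravel D (layers N) v []) n w"
  shows "n \<le> layers N" "w = to_nat (q :: (nat \<times> nat \<times> nat) list) \<Longrightarrow> n \<le> length q"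
proof -
  let ?\<phi> = "unravel D (layers N) v []"
  obtain xs where xs: "length xs = Suc n" "last xs = w"
    "\<forall>i<n. \<exists>c. Pos (EA c (Vr (xs ! i)) (Vr (xs ! Suc i))) \<in> ?\<phi>"
    using assms unfolding has_path_def by blast
  have *: "i \<le> n \<Longrightarrow> xs ! i = to_nat q \<Longrightarrow> i \<le> length q" for i and q :: "(nat \<times> nat \<times> nat) list"
  proof (induction i arbitrary: q)
    case (Suc i)
    then obtain c where "Pos (EA c (Vr (xs ! i)) (Vr (xs ! Suc i))) \<in> ?\<phi>"
      using xs(3) Suc_le_lessD by blast
    then obtain q' and m u :: nat where q': "Vr (xs ! i) = Vr (to_nat q')"
      "Vr (xs ! Suc i) = Vr (to_nat ((m, colour_code c, u) # q'))"
      by (rule edge_unravel_root)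
    then have "i \<le> length q'" "q = (m, colour_code c, u) # q'" using Suc by auto
    then show ?case by simp
  qed simp
  have w: "w = xs ! n" using xs(1,2) by (metis diff_Suc_1 last_conv_nth length_0_conv nat.simps(3))
  then show "w = to_nat q \<Longrightarrow> n \<le> length q" for q :: "(nat \<times> nat \<times> nat) list" using * by simp
  show "n \<le> layers N"
  proof (cases n)
    case (Suc m)
    then obtain c where "Pos (EA c (Vr (xs ! m)) (Vr (xs ! Suc m))) \<in> ?\<phi>" using xs(3) by auto
    then obtain q' k u where "Vr (xs ! Suc m) = Vr (to_nat ((k, colour_code c, u) # q'))"
      "k < path_level q'" "length q' + path_level q' \<le> layers N"
      by (rule edge_unravel_root)
    moreover from this have "n \<le> length ((k, colour_code c, u) # q')"
      using Suc by (intro *) auto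
    ultimately show ?thesis by simp
  qed simp
qed

text \<open>A child of \<open>q\<close> is given by a layer below the level of \<open>q\<close>, a
  colour and a selected vertex, and that level is at most
  \<open>layers N - length q\<close>.\<close>

lemma fanout_unravel:
  fixes q :: "(nat \<times> nat \<times> nat) list"
  shows "fanout (unravel D (layers N) v []) (to_nat q) \<le>
    card Col * delta_max N * capacity Col N * (layers N - length q)"
proof -
  let ?\<phi> = "unravel D (layers N) v []"
  let ?Y = "{y. \<exists>c. Pos (EA c (Vr (to_nat q)) (Vr y)) \<in> ?\<phi>}"
  show ?thesis
  \<comment> \<open>The variable of \<open>q\<close> need not occur in the formula; the bound on its
    level comes from an outgoing edge.\<close>
  proof (cases "?Y = {}")
    case True
    then show ?thesis unfolding fanout_def by (metis card.empty le0)
  next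
    case False
    then obtain y c where "Pos (EA c (Vr (to_nat q)) (Vr y)) \<in> ?\<phi>" by blast
    then have lev: "length q + path_level q \<le> layers N"
      by (rule edge_unravel_root) auto
    let ?S = "SIGMA m:{..<path_level q}. SIGMA c:Col. selected D m (path_end v q) c"
    have "?Y \<subseteq> (\<lambda>(m, c, u). to_nat ((m, colour_code c, u) # q)) ` ?S"
    proof
      fix y assume "y \<in> ?Y"
      then obtain c where "Pos (EA c (Vr (to_nat q)) (Vr y)) \<in> ?\<phi>" by blast
      then obtain q' m u where "c \<in> Col" "Vr (to_nat q) = Vr (to_nat q')"
        "Vr y = Vr (to_nat ((m, colour_code c, u) # q'))"
        "m < path_level q'" "u \<in> selected D m (path_end v q') c"
        by (rule edge_unravel_root)
      then show "y \<in> (\<lambda>(m, c, u). to_nat ((m, colour_code c, u) # q)) ` ?S"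
        by (intro image_eqI[of _ _ "(m, c, u)"]) auto
    qed
    moreover have fin: "finite ?S"
      by (intro finite_SigmaI finite_selected finite_Col) simp
    ultimately have "fanout ?\<phi> (to_nat q) \<le> card ?S"
      unfolding fanout_def by (meson card_image_le card_mono finite_imageI order_trans)
    also have "card ?S = (\<Sum>m<path_level q. \<Sum>c\<in>Col. card (selected D m (path_end v q) c))"
      by (simp add: card_SigmaI finite_selected finite_Col)
    also have "\<dots> \<le> (\<Sum>m<path_level q. \<Sum>c\<in>Col. delta_max N * capacity Col N)"
    proof (intro sum_mono)
      fix m c assume "m \<in> {..<path_level q}"
      then have "m \<in> {0..layers N}" using lev by simp
      then have "dim N m \<le> delta_max N" unfolding delta_max_def by (intro Max_ge) auto
      then show "card (selected D m (path_end v q) c) \<le> delta_max N * capacity Col N"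
        by (intro order_trans[OF card_selected] mult_right_mono) auto
    qed
    also have "\<dots> = path_level q * (card Col * delta_max N * capacity Col N)" by simp
    also have "\<dots> \<le> (layers N - length q) * (card Col * delta_max N * capacity Col N)"
      using lev by (intro mult_right_mono) auto
    finally show ?thesis by (simp add: mult.commute)
  qed
qed

text \<open>The depth of a variable is at most the length of the path it encodes, so the fan-out
  allowed by depth is at least the one proved in terms of that length.\<close>

lemma df_bounded_unravel:
  "df_bounded (layers N) (card Col * delta_max N * capacity Col N) (unravel D (layers N) v [])"
    (is "df_bounded _ ?f ?\<phi>")
  unfolding df_bounded_def
proof (intro ballI conjI allI impI)
  fix w assume "w \<in> fvars ?\<phi>"
  then obtain q :: "(nat \<times> nat \<times> nat) list" where q: "w = to_nat q"
    using fvars_unravel_below unfolding below_def by blast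
  show "n \<le> layers N" if "has_path ?\<phi> n w" for n using has_path_unravel(1)[OF that] .
  have "has_path ?\<phi> 0 w" unfolding has_path_def by (intro exI[of _ "[w]"]) simp
  then have "has_path ?\<phi> (var_depth ?\<phi> w) w"
    unfolding var_depth_def using has_path_unravel(1) by (rule GreatestI_nat)
  then have "var_depth ?\<phi> w \<le> length q" using has_path_unravel(2) q by blast
  then have "?f * (layers N - length q) \<le> ?f * (layers N - var_depth ?\<phi> w)"
    by (intro mult_left_mono) auto
  then show "fanout ?\<phi> w \<le> ?f * (layers N - var_depth ?\<phi> w)"
    using fanout_unravel[of D v q] unfolding q by (rule order_trans[rotated])
qed

section \<open>The unravelling matches its own dataset and is captured\<close>

lemma sat_unravel:
  assumes "finite D"
    and \<nu>: "\<And>e (q :: (nat \<times> nat \<times> nat) list). \<nu> (to_nat (e # q)) = snd (snd e)"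
  shows "\<nu> (to_nat p) = v \<Longrightarrow> sat D \<nu> (unravel D l v p)"
proof (induction l arbitrary: v p)
  case 0
  then show ?case by (auto simp: sat_def)
next
  case (Suc l)
  \<comment> \<open>Siblings record different vertices, so reading off the last vertex of a path
    respects the inequalities.\<close>
  have "inj_on (\<nu> \<circ> (\<lambda>u. to_nat ((l, colour_code c, u) # p))) S" for c S
    by (auto simp: inj_on_def \<nu>)
  moreover have "sat D \<nu> (unravel D l u ((l, colour_code c, u) # p))" for c u
    by (rule Suc.IH) (simp add: \<nu>)
  moreover have "EA c (Cst v) (Cst u) \<in> D" if "u \<in> selected D l v c" for c u
    using that selected_subset[OF assms(1)] by (auto simp: neighbours_def)
  ultimately show ?case
    using Suc.IH[OF Suc.prems] Suc.prems unfolding unravel.simps sat_Un sat_UN sat_fan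
    by (auto simp: \<nu>)
qed

lemma fvars_unravel_dconsts:
  assumes "finite D"
    and \<nu>: "\<And>e (q :: (nat \<times> nat \<times> nat) list). \<nu> (to_nat (e # q)) = snd (snd e)"
  shows "\<nu> (to_nat p) \<in> dconsts D \<Longrightarrow> \<nu> ` fvars (unravel D l v p) \<subseteq> dconsts D"
proof (induction l arbitrary: v p)
  case 0
  then show ?case by (auto simp: fvars_def)
next
  case (Suc l)
  have sel: "u \<in> dconsts D" if "u \<in> selected D l v c" for u c
  proof -
    have "EA c (Cst v) (Cst u) \<in> D"
      using that selected_subset[OF assms(1)] by (auto simp: neighbours_def)
    then show ?thesis unfolding dconsts_def by force
  qed
  have "\<nu> ` fvars (fan c (to_nat p) (selected D l v c) (\<lambda>u. to_nat ((l, colour_code c, u) # p))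
       (\<lambda>u. unravel D l u ((l, colour_code c, u) # p))) \<subseteq> dconsts D" for c
  proof (rule order_trans[OF image_mono[OF fvars_fan]])
    have "\<nu> ` fvars (unravel D l u ((l, colour_code c, u) # p)) \<subseteq> dconsts D" if "u \<in> selected D l v c" for u
      using sel[OF that] by (intro Suc.IH) (simp add: \<nu>)
    then show "\<nu> ` insert (to_nat p) (\<Union>u\<in>selected D l v c. insert (to_nat ((l, colour_code c, u) # p))
        (fvars (unravel D l u ((l, colour_code c, u) # p)))) \<subseteq> dconsts D"
      using sel Suc.prems by (auto simp: \<nu>)
  qed
  then show ?case
    using Suc.IH[OF Suc.prems] unfolding unravel.simps fvars_Un fvars_UN by blast
qed

lemma rule_sig_unravel:
  "i < \<delta> \<Longrightarrow> rule_sig Col \<delta> (unravel D l v p, UA i t)"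
proof -
  have "a \<in> unravel D l v p \<Longrightarrow> case a of Pos a \<Rightarrow> sig_atom Col \<delta> a | Neq _ _ \<Rightarrow> True" for a
    by (induction l arbitrary: v p) (auto simp: sig_atom_def fan_def)
  then show "i < \<delta> \<Longrightarrow> ?thesis" by (simp add: rule_sig_def sig_atom_def)
qed

lemma caps_le_capacity: "m \<in> {1..layers N} \<Longrightarrow> caps Col N (layers N) (thr N) m \<le> capacity Col N"
  unfolding capacity_def by (intro Max_ge) auto

text \<open>With the threshold of the classification as \<alpha> and the feature over
  \<open>D\<close> reaching it, the minimum in \<open>lab_unravel_le\<close> is that
  threshold.\<close>

lemma captures_unravel:
  assumes "finite D" "i < \<delta>" "thr N \<le> lab Col N D (layers N) v i"
  shows "captures Col \<delta> N (unravel D (layers N) v [], UA i (Vr (to_nat ([] :: (nat \<times> nat \<times> nat) list))))"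
  unfolding captures_def
proof (intro allI impI subsetI)
  fix D' a
  assume D': "sig_dataset Col \<delta> D'" and
    a: "a \<in> T_rule (unravel D (layers N) v [], UA i (Vr (to_nat ([] :: (nat \<times> nat \<times> nat) list)))) D'"
  let ?r = "to_nat ([] :: (nat \<times> nat \<times> nat) list)"
  obtain \<nu> where \<nu>: "a = UA i (Cst (\<nu> ?r))" "\<nu> ?r \<in> dconsts D'"
    "sat D' \<nu> (unravel D (layers N) v [])"
    using a by (auto simp: T_rule_def sat_def rule_vars_def)
  have "finite D'" using D' by (simp add: sig_dataset_def is_dataset_def)
  then have "min (lab Col N D (layers N) v i) (thr N) \<le> lab Col N D' (layers N) (\<nu> ?r) i"
    using assms \<nu>(3) caps_le_capacity by (intro lab_unravel_le) (auto simp: dim_layers)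
  then show "a \<in> T_gnn Col \<delta> N D'"
    using assms \<nu> by (auto simp: T_gnn_def)
qed

lemma unravel_derives:
  assumes "finite D" "v \<in> dconsts D"
  shows "UA i (Cst v) \<in> T_rule (unravel D l v [], UA i (Vr (to_nat ([] :: (nat \<times> nat \<times> nat) list)))) D"
proof -
  \<comment> \<open>Each variable is decoded to its path and sent to the last vertex on it, with
    \<open>v\<close> as the default for the empty path.\<close>
  define \<nu> where "\<nu> n = path_end v (from_nat n)" for n
  have \<nu>: "\<nu> (to_nat (e # q)) = snd (snd e)" "\<nu> (to_nat ([] :: (nat \<times> nat \<times> nat) list)) = v"
    for e and q :: "(nat \<times> nat \<times> nat) list"
    by (simp_all add: \<nu>_def path_end_def)
  have "sat D \<nu> (unravel D l v [])" using sat_unravel[OF assms(1) \<nu>] .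
  moreover have "\<nu> ` fvars (unravel D l v []) \<subseteq> dconsts D"
    using assms \<nu> by (intro fvars_unravel_dconsts) auto
  ultimately show ?thesis
    using assms(2) \<nu>(2) unfolding T_rule_def sat_def
    by (auto simp: rule_vars_def intro!: exI[of _ \<nu>])
qed

end

subsection \<open>Renaming and finiteness\<close>

lemma trm_vars_rterm: "trm_vars (rterm \<rho> t) = \<rho> ` trm_vars t"
  by (cases t) auto

lemma atom_vars_ratom: "atom_vars (ratom \<rho> a) = \<rho> ` atom_vars a"
  by (cases a) (auto simp: trm_vars_rterm)

lemma lit_vars_rlit: "lit_vars (rlit \<rho> l) = \<rho> ` lit_vars l"
  by (cases l) (auto simp: trm_vars_rterm atom_vars_ratom)

lemma rule_vars_rename_rule: "rule_vars (rename_rule \<rho> r) = \<rho> ` rule_vars r"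
  by (auto simp: rule_vars_def rename_rule_def fvars_def lit_vars_rlit atom_vars_ratom)

lemma rterm_comp: "rterm \<sigma> (rterm \<rho> t) = rterm (\<sigma> \<circ> \<rho>) t"
  by (cases t) auto

lemma ratom_comp: "ratom \<sigma> (ratom \<rho> a) = ratom (\<sigma> \<circ> \<rho>) a"
  by (cases a) (auto simp: rterm_comp)

lemma rlit_comp: "rlit \<sigma> (rlit \<rho> l) = rlit (\<sigma> \<circ> \<rho>) l"
  by (cases l) (auto simp: rterm_comp ratom_comp)

lemma rename_rule_comp: "rename_rule \<sigma> (rename_rule \<rho> r) = rename_rule (\<sigma> \<circ> \<rho>) r"
  by (simp add: rename_rule_def ratom_comp rlit_comp image_image)

lemma rterm_ident: "(\<And>x. x \<in> trm_vars t \<Longrightarrow> \<rho> x = x) \<Longrightarrow> rterm \<rho> t = t"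
  by (cases t) auto

lemma ratom_ident: "(\<And>x. x \<in> atom_vars a \<Longrightarrow> \<rho> x = x) \<Longrightarrow> ratom \<rho> a = a"
  by (cases a) (auto intro!: rterm_ident)

lemma rlit_ident: "(\<And>x. x \<in> lit_vars l \<Longrightarrow> \<rho> x = x) \<Longrightarrow> rlit \<rho> l = l"
  by (cases l) (auto intro!: rterm_ident ratom_ident)

lemma rename_rule_ident:
  assumes "\<And>x. x \<in> rule_vars r \<Longrightarrow> \<rho> x = x"
  shows "rename_rule \<rho> r = r"
proof -
  have "rlit \<rho> l = l" if "l \<in> fst r" for l
    using that by (intro rlit_ident assms) (auto simp: rule_vars_def fvars_def)
  moreover have "ratom \<rho> (snd r) = snd r"
    by (intro ratom_ident assms) (auto simp: rule_vars_def)
  ultimately show ?thesis by (simp add: rename_rule_def)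
qed

text \<open>The first renaming followed by the inverse of the second relates the two rules.\<close>

lemma eq_upto_renaming_common:
  assumes inj: "inj_on \<rho> (rule_vars r)" "inj_on \<rho>' (rule_vars r')"
    and eq: "rename_rule \<rho> r = rename_rule \<rho>' r'"
  shows "eq_upto_renaming r r'"
  unfolding eq_upto_renaming_def
proof (intro exI conjI)
  let ?inv = "inv_into (rule_vars r') \<rho>'"
  have im: "\<rho> ` rule_vars r = \<rho>' ` rule_vars r'"
    using arg_cong[OF eq, of rule_vars] by (simp add: rule_vars_rename_rule)
  show "bij_betw (?inv \<circ> \<rho>) (rule_vars r) (rule_vars r')"
    using inj im by (metis bij_betw_def bij_betw_inv_into bij_betw_trans)
  have "rename_rule (?inv \<circ> \<rho>) r = rename_rule (?inv \<circ> \<rho>') r'"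
    by (metis eq rename_rule_comp)
  also have "\<dots> = r'"
    using inj(2) by (intro rename_rule_ident) simp
  finally show "rename_rule (?inv \<circ> \<rho>) r = r'" .
qed

section \<open>Rule application under renaming\<close>

lemma sterm_rterm: "(\<And>x. x \<in> trm_vars t \<Longrightarrow> \<nu>' (\<rho> x) = \<nu> x) \<Longrightarrow> sterm \<nu>' (rterm \<rho> t) = sterm \<nu> t"
  by (cases t) auto

lemma satom_ratom: "(\<And>x. x \<in> atom_vars a \<Longrightarrow> \<nu>' (\<rho> x) = \<nu> x) \<Longrightarrow> satom \<nu>' (ratom \<rho> a) = satom \<nu> a"
  by (cases a) (auto intro!: sterm_rterm)

lemma T_rule_eq_upto_renaming:
  assumes "eq_upto_renaming r r'"
  shows "T_rule r D \<subseteq> T_rule r' D"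
proof
  fix a assume "a \<in> T_rule r D"
  then obtain \<nu> where \<nu>: "a = satom \<nu> (snd r)" "\<forall>x\<in>rule_vars r. \<nu> x \<in> dconsts D"
    "\<And>a. Pos a \<in> fst r \<Longrightarrow> satom \<nu> a \<in> D" "\<And>s t. Neq s t \<in> fst r \<Longrightarrow> sterm \<nu> s \<noteq> sterm \<nu> t"
    by (auto simp: T_rule_def)
  obtain \<rho> where bij: "bij_betw \<rho> (rule_vars r) (rule_vars r')" and r': "rename_rule \<rho> r = r'"
    using assms by (auto simp: eq_upto_renaming_def)
  define \<nu>' where "\<nu>' = \<nu> \<circ> inv_into (rule_vars r) \<rho>"
  have \<nu>': "\<nu>' (\<rho> x) = \<nu> x" if "x \<in> rule_vars r" for x
    using that bij by (simp add: \<nu>'_def bij_betw_def)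
  have atom: "satom \<nu>' (ratom \<rho> b) = satom \<nu> b" if "Pos b \<in> fst r" for b
    using that by (intro satom_ratom \<nu>') (force simp: rule_vars_def fvars_def)
  have trm: "sterm \<nu>' (rterm \<rho> s) = sterm \<nu> s" "sterm \<nu>' (rterm \<rho> t) = sterm \<nu> t"
    if "Neq s t \<in> fst r" for s t
    using that by (intro sterm_rterm \<nu>'; force simp: rule_vars_def fvars_def)+
  have "a = satom \<nu>' (snd r')"
    unfolding \<nu>(1) r'[symmetric] rename_rule_def snd_conv
    by (intro satom_ratom[symmetric] \<nu>') (simp add: rule_vars_def)
  moreover have "\<forall>x\<in>rule_vars r'. \<nu>' x \<in> dconsts D"
    using bij \<nu>(2) \<nu>' unfolding bij_betw_def by force
  moreover have "satom \<nu>' b \<in> D" if l: "Pos b \<in> fst r'" for b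
  proof -
    obtain l where "l \<in> fst r" "Pos b = rlit \<rho> l"
      using l unfolding r'[symmetric] rename_rule_def fst_conv by blast
    then show ?thesis using \<nu>(3) atom by (cases l) auto
  qed
  moreover have "sterm \<nu>' s \<noteq> sterm \<nu>' t" if l: "Neq s t \<in> fst r'" for s t
  proof -
    obtain l where "l \<in> fst r" "Neq s t = rlit \<rho> l"
      using l unfolding r'[symmetric] rename_rule_def fst_conv by blast
    then show ?thesis using \<nu>(4) trm by (cases l) auto
  qed
  ultimately show "a \<in> T_rule r' D" unfolding T_rule_def by blast
qed

text \<open>Renaming each rule onto an initial segment of the naturals leaves finitely many
  canonical forms. Picking one rule of \<open>R\<close> per form, instead of the form itself, avoids
  showing that \<open>R\<close> is closed under renaming.\<close>

lemma finite_representatives: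
  fixes R :: "'col rule set"
  assumes "finite Col"
    and sig: "\<And>r. r \<in> R \<Longrightarrow> rule_sig Col \<delta> r"
    and fin: "\<And>r. r \<in> R \<Longrightarrow> finite (rule_vars r)"
    and card: "\<And>r. r \<in> R \<Longrightarrow> card (rule_vars r) \<le> n"
    and vars: "\<And>r. r \<in> R \<Longrightarrow> (\<Union>l\<in>fst r. lit_terms l) \<union> atom_terms (snd r) \<subseteq> Vr ` rule_vars r"
  shows "\<exists>P\<subseteq>R. finite P \<and> (\<forall>r\<in>R. \<exists>r'\<in>P. eq_upto_renaming r r')"
proof -
  have "\<exists>\<rho>. bij_betw \<rho> (rule_vars r) {0..<card (rule_vars r)}" if "r \<in> R" for r
    using ex_bij_betw_finite_nat[OF fin[OF that]] .
  then obtain \<rho> where \<rho>: "\<And>r. r \<in> R \<Longrightarrow> bij_betw (\<rho> r) (rule_vars r) {0..<card (rule_vars r)}"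
    by metis
  let ?canon = "\<lambda>r. rename_rule (\<rho> r) r"
  let ?T = "Vr ` {..<n}"
  let ?A = "(\<lambda>(c, s, t). EA c s t) ` (Col \<times> ?T \<times> ?T) \<union> (\<lambda>(i, t). UA i t) ` ({..<\<delta>} \<times> ?T)"
  let ?L = "Pos ` ?A \<union> (\<lambda>(s, t). Neq s t) ` (?T \<times> ?T)"
  have "?canon r \<in> Pow ?L \<times> ?A" if r: "r \<in> R" for r
  proof -
    have trm: "rterm (\<rho> r) t \<in> ?T" if "t \<in> Vr ` rule_vars r" for t
      using that \<rho>[OF r] card[OF r] by (fastforce simp: bij_betw_def)
    have atom: "ratom (\<rho> r) a \<in> ?A" if "atom_terms a \<subseteq> Vr ` rule_vars r" "sig_atom Col \<delta> a" for a
    proof (cases a)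
      case (EA c s t)
      then have "rterm (\<rho> r) s \<in> ?T" "rterm (\<rho> r) t \<in> ?T" "c \<in> Col"
        using that by (auto intro!: trm simp: sig_atom_def)
      then show ?thesis unfolding EA by (intro UnI1 image_eqI[of _ _ "(c, rterm (\<rho> r) s, rterm (\<rho> r) t)"]) auto
    next
      case (UA i t)
      then have "rterm (\<rho> r) t \<in> ?T" "i < \<delta>"
        using that by (auto intro!: trm simp: sig_atom_def)
      then show ?thesis unfolding UA by (intro UnI2 image_eqI[of _ _ "(i, rterm (\<rho> r) t)"]) auto
    qed
    have "rlit (\<rho> r) l \<in> ?L" if l: "l \<in> fst r" for l
    proof (cases l)
      case (Pos a)
      then have "ratom (\<rho> r) a \<in> ?A"
        using l vars[OF r] sig[OF r] unfolding rule_sig_def by (intro atom) force+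
      then show ?thesis unfolding Pos rlit.simps by (rule UnI1[OF imageI])
    next
      case (Neq s t)
      then have "s \<in> Vr ` rule_vars r" "t \<in> Vr ` rule_vars r"
        using l vars[OF r] by force+
      then show ?thesis unfolding Neq rlit.simps
        by (intro UnI2 image_eqI[of _ _ "(rterm (\<rho> r) s, rterm (\<rho> r) t)"] SigmaI trm) auto
    qed
    moreover have "ratom (\<rho> r) (snd r) \<in> ?A"
      using vars[OF r] sig[OF r] unfolding rule_sig_def by (intro atom) auto
    ultimately show ?thesis unfolding rename_rule_def by blast
  qed
  then have "?canon ` R \<subseteq> Pow ?L \<times> ?A" by blast
  moreover have "finite (Pow ?L \<times> ?A)" using assms(1) by simp
  ultimately have finC: "finite (?canon ` R)" by (rule finite_subset)
  define pick where "pick k = (SOME r. r \<in> R \<and> ?canon r = k)" for k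
  have pick: "pick (?canon r) \<in> R \<and> ?canon (pick (?canon r)) = ?canon r" if "r \<in> R" for r
    unfolding pick_def by (rule someI[of _ r]) (simp add: that)
  show ?thesis
  proof (intro exI conjI ballI)
    show "pick ` ?canon ` R \<subseteq> R" using pick by blast
    show "finite (pick ` ?canon ` R)" using finC by simp
    fix r assume r: "r \<in> R"
    show "\<exists>r'\<in>pick ` ?canon ` R. eq_upto_renaming r r'"
    proof (rule bexI[of _ "pick (?canon r)"])
      show "eq_upto_renaming r (pick (?canon r))"
        using pick[OF r] \<rho>[OF r] \<rho>[of "pick (?canon r)"]
        by (intro eq_upto_renaming_common[of "\<rho> r" _ "\<rho> (pick (?canon r))"])
          (simp_all add: bij_betw_def)
    qed (use r in blast)
  qed
qed

section \<open>Bounding the number of variables of a tree-like rule\<close>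

definition edges :: "'col lit set \<Rightarrow> (nat \<times> nat) set" where
  "edges \<phi> = {(a, b). \<exists>c. Pos (EA c (Vr a) (Vr b)) \<in> \<phi>}"

lemma edges_mono: "\<phi> \<subseteq> \<psi> \<Longrightarrow> edges \<phi> \<subseteq> edges \<psi>"
  by (auto simp: edges_def)

lemma finite_tree_like: "tree_like \<phi> x \<Longrightarrow> finite \<phi>"
proof (induction rule: tree_like.induct)
  case (tl_edge ys phis x)
  have "{Neq (Vr (ys ! i)) (Vr (ys ! j)) | i j. i < j \<and> j < length ys} \<subseteq>
      (\<lambda>(i, j). Neq (Vr (ys ! i)) (Vr (ys ! j))) ` ({..<length ys} \<times> {..<length ys})"
    by force
  then have "finite {Neq (Vr (ys ! i)) (Vr (ys ! j)) | i j. i < j \<and> j < length ys}"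
    by (rule finite_subset) simp
  then show ?case using tl_edge by auto
qed auto

lemma tree_like_lit_terms: "tree_like \<phi> x \<Longrightarrow> l \<in> \<phi> \<Longrightarrow> lit_terms l \<subseteq> range Vr"
  by (induction rule: tree_like.induct) auto

text \<open>Bounds on depth and fan-out limit the number of variables only if all of them hang from
  the root.\<close>

lemma tree_like_reachable: "tree_like \<phi> x \<Longrightarrow> v \<in> fvars \<phi> \<Longrightarrow> (x, v) \<in> (edges \<phi>)\<^sup>*"
proof (induction arbitrary: v rule: tree_like.induct)
  case (tl_conj \<phi>1 x \<phi>2)
  then show ?case
    using rtrancl_mono[OF edges_mono[of \<phi>1 "\<phi>1 \<union> \<phi>2"]] rtrancl_mono[OF edges_mono[of \<phi>2 "\<phi>1 \<union> \<phi>2"]]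
    by (auto simp: fvars_Un)
next
  case (tl_edge ys phis x c)
  let ?\<phi> = "(\<Union>i<length ys. insert (Pos (EA c (Vr x) (Vr (ys ! i)))) (phis ! i)) \<union>
    {Neq (Vr (ys ! i)) (Vr (ys ! j)) | i j. i < j \<and> j < length ys}"
  have y: "(x, ys ! i) \<in> (edges ?\<phi>)\<^sup>*" if "i < length ys" for i
    using that by (auto simp: edges_def)
  have sub: "(edges (phis ! i))\<^sup>* \<subseteq> (edges ?\<phi>)\<^sup>*" if "i < length ys" for i
    using that by (intro rtrancl_mono edges_mono) auto
  have "v = x \<or> (\<exists>i<length ys. v = ys ! i \<or> v \<in> fvars (phis ! i))"
    using tl_edge.prems unfolding fvars_Un fvars_UN fvars_insert
    by (auto simp: fvars_def)
  then show ?case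
  proof (elim disjE exE conjE)
    fix i assume i: "i < length ys" "v \<in> fvars (phis ! i)"
    then have "(ys ! i, v) \<in> (edges ?\<phi>)\<^sup>*" using tl_edge.IH sub by blast
    then show ?thesis using y[OF i(1)] by (rule rtrancl_trans[rotated])
  qed (use y in auto)
qed (auto simp: fvars_def)

lemma has_path_relpow: "(x, v) \<in> edges \<phi> ^^ n \<Longrightarrow> has_path \<phi> n v"
proof (induction n arbitrary: v)
  case 0
  show ?case unfolding has_path_def by (intro exI[of _ "[v]"]) simp
next
  case (Suc n)
  then obtain u where u: "has_path \<phi> n u" "(u, v) \<in> edges \<phi>" by auto
  then obtain xs where xs: "length xs = Suc n" "last xs = u"
    "\<forall>i<n. \<exists>c. Pos (EA c (Vr (xs ! i)) (Vr (xs ! Suc i))) \<in> \<phi>"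
    unfolding has_path_def by blast
  have "xs ! n = u" using xs(1,2) by (metis diff_Suc_1 last_conv_nth length_0_conv nat.simps(3))
  then have "\<exists>c. Pos (EA c (Vr ((xs @ [v]) ! i)) (Vr ((xs @ [v]) ! Suc i))) \<in> \<phi>" if "i < Suc n" for i
    using that xs u(2) by (cases "i = n") (auto simp: nth_append edges_def)
  then show ?case using xs(1) unfolding has_path_def by (intro exI[of _ "xs @ [v]"]) simp
qed

lemma finite_fvars: "finite \<phi> \<Longrightarrow> finite (fvars \<phi>)"
proof -
  have t: "finite (trm_vars t)" for t by (cases t) auto
  then have "finite (atom_vars a)" for a :: "'a atom" by (cases a) auto
  then have "finite (lit_vars l)" for l :: "'a lit" using t by (cases l) auto
  then show "finite \<phi> \<Longrightarrow> finite (fvars \<phi>)" by (simp add: fvars_def)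
qed

text \<open>At most \<open>(f * d) ^ n\<close> variables are reached by \<open>n\<close> edges from
  the root, and each variable is reached within \<open>d\<close> edges.\<close>

lemma card_fvars_tree_like:
  assumes tl: "tree_like \<phi> x" and df: "df_bounded d f \<phi>"
  shows "card (fvars \<phi>) \<le> (\<Sum>n\<le>d. (f * d) ^ n)"
proof -
  let ?E = "edges \<phi>"
  have fin: "finite (fvars \<phi>)" by (intro finite_fvars finite_tree_like[OF tl])
  have E: "u \<in> fvars \<phi> \<and> v \<in> fvars \<phi>" if "(u, v) \<in> ?E" for u v
    using that unfolding edges_def fvars_def by fastforce
  have out: "card (?E `` {v}) \<le> f * d" for v
  proof (cases "v \<in> fvars \<phi>")
    case True
    have "card (?E `` {v}) = fanout \<phi> v"
      unfolding fanout_def edges_def by (rule arg_cong[of _ _ card]) auto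
    also have "\<dots> \<le> f * (d - var_depth \<phi> v)" using df True by (simp add: df_bounded_def)
    also have "\<dots> \<le> f * d" by simp
    finally show ?thesis .
  next
    case False
    \<comment> \<open>\<open>df_bounded\<close> says nothing about variables outside the formula,
      such as the root of an empty body, but these have no outgoing edges.\<close>
    then have "?E `` {v} = {}" using E by blast
    then show ?thesis by simp
  qed
  have level: "finite ((?E ^^ n) `` {x}) \<and> card ((?E ^^ n) `` {x}) \<le> (f * d) ^ n" for n
  proof (induction n)
    case (Suc n)
    have eq: "(?E ^^ Suc n) `` {x} = (\<Union>v\<in>(?E ^^ n) `` {x}. ?E `` {v})" by auto
    then have "(?E ^^ Suc n) `` {x} \<subseteq> fvars \<phi>" using E by blast
    moreover have "card ((?E ^^ Suc n) `` {x}) \<le> (\<Sum>v\<in>(?E ^^ n) `` {x}. card (?E `` {v}))"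
      unfolding eq by (rule card_UN_le) (use Suc in blast)
    moreover have "\<dots> \<le> card ((?E ^^ n) `` {x}) * (f * d)"
      using sum_bounded_above[of "(?E ^^ n) `` {x}" "\<lambda>v. card (?E `` {v})" "f * d"] out by simp
    moreover have "\<dots> \<le> (f * d) ^ n * (f * d)" using Suc by (intro mult_right_mono) auto
    moreover have "(f * d) ^ n * (f * d) = (f * d) ^ Suc n" by simp
    ultimately show ?case using finite_subset[OF _ fin] by (metis order_trans)
  qed simp
  have "fvars \<phi> \<subseteq> (\<Union>n\<le>d. (?E ^^ n) `` {x})"
  proof
    fix v assume v: "v \<in> fvars \<phi>"
    then obtain n where n: "(x, v) \<in> ?E ^^ n"
      using tree_like_reachable[OF tl] rtrancl_imp_relpow by blast
    then have "n \<le> d" using has_path_relpow df v unfolding df_bounded_def by blast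
    then show "v \<in> (\<Union>n\<le>d. (?E ^^ n) `` {x})" using n by auto
  qed
  then have "card (fvars \<phi>) \<le> card (\<Union>n\<le>d. (?E ^^ n) `` {x})"
    using level by (intro card_mono) auto
  also have "\<dots> \<le> (\<Sum>n\<le>d. card ((?E ^^ n) `` {x}))" by (rule card_UN_le) simp
  also have "\<dots> \<le> (\<Sum>n\<le>d. (f * d) ^ n)" using level by (intro sum_mono) blast
  finally show ?thesis .
qed

subsection \<open>Equivalence\<close>

context monotonic_gnn
begin

lemma is_PiN_exists: "\<exists>P. is_PiN Col \<delta> N P"
proof -
  let ?f = "card Col * delta_max N * capacity Col N"
  let ?R = "{r. rule_sig Col \<delta> r \<and> tree_like_rule (layers N) ?f r \<and> captures Col \<delta> N r}"
  have tl: "is_rule r \<and> finite (rule_vars r) \<and> card (rule_vars r) \<le> Suc (\<Sum>n\<le>layers N. (?f * layers N) ^ n) \<and>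
      (\<Union>l\<in>fst r. lit_terms l) \<union> atom_terms (snd r) \<subseteq> Vr ` rule_vars r" if R: "r \<in> ?R" for r :: "'col rule"
  proof -
    obtain \<phi> i x where r: "r = (\<phi>, UA i (Vr x))" "tree_like \<phi> x" "df_bounded (layers N) ?f \<phi>"
      using R unfolding tree_like_rule_def by blast
    have rv: "rule_vars r = insert x (fvars \<phi>)" by (simp add: r(1) rule_vars_def)
    have fin: "finite \<phi>" "finite (fvars \<phi>)" using finite_tree_like[OF r(2)] finite_fvars by auto
    \<comment> \<open>The head variable need not occur in the body, for instance when the body is
      empty, hence the extra one.\<close>
    have "card (rule_vars r) \<le> Suc (card (fvars \<phi>))" unfolding rv by (rule card_insert_le_m1) auto
    moreover have "lit_terms l \<subseteq> Vr ` fvars \<phi>" if "l \<in> \<phi>" for l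
      using that tree_like_lit_terms[OF r(2) that] by (fastforce simp: fvars_def lit_vars_def)
    ultimately show ?thesis
      using card_fvars_tree_like[OF r(2,3)] fin rv by (auto simp: r(1) is_rule_def)
  qed
  have "\<exists>P\<subseteq>?R. finite P \<and> (\<forall>r\<in>?R. \<exists>r'\<in>P. eq_upto_renaming r r')"
  proof (rule finite_representatives[OF finite_Col])
    show "rule_sig Col \<delta> r" if "r \<in> ?R" for r using that by simp
  qed (use tl in blast)+
  then obtain P where P: "P \<subseteq> ?R" "finite P" "\<forall>r\<in>?R. \<exists>r'\<in>P. eq_upto_renaming r r'" by blast
  then have "is_PiN Col \<delta> N P"
    unfolding is_PiN_def Let_def is_program_def using tl by blast
  then show ?thesis ..
qed

text \<open>Tree-like rules have unary heads, while the decoding keeps all edges, so the binary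
  facts of \<open>D\<close> are added on the program side. For unary facts, soundness is the
  definition of capturing, and completeness comes from the unravelling of \<open>D\<close>, up to
  renaming.\<close>

lemma T_gnn_eq_T_prog:
  assumes P: "is_PiN Col \<delta> N P" and D: "sig_dataset Col \<delta> D"
  shows "T_gnn Col \<delta> N D = T_prog P D \<union> {a \<in> D. \<exists>c s t. a = EA c s t}"
proof
  have finD: "finite D" using D by (simp add: sig_dataset_def is_dataset_def)
  have complete: "\<exists>r'\<in>P. eq_upto_renaming r r'"
    if "rule_sig Col \<delta> r" "tree_like_rule (layers N) (card Col * delta_max N * capacity Col N) r"
      "captures Col \<delta> N r" for r
    using P that unfolding is_PiN_def Let_def by blast
  have Cst: "\<exists>n. t = Cst n" if "a \<in> D" "t \<in> atom_terms a" for a t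
  proof -
    have "trm_vars t = {}" using D that unfolding sig_dataset_def is_dataset_def atom_vars_def by blast
    then show ?thesis by (cases t) auto
  qed
  show "T_prog P D \<union> {a \<in> D. \<exists>c s t. a = EA c s t} \<subseteq> T_gnn Col \<delta> N D"
  proof (intro Un_least subsetI)
    fix a assume "a \<in> T_prog P D"
    then show "a \<in> T_gnn Col \<delta> N D"
      using P D unfolding is_PiN_def Let_def T_prog_def captures_def by blast
  next
    fix a assume a: "a \<in> {a \<in> D. \<exists>c s t. a = EA c s t}"
    then obtain c s t where st: "a = EA c s t" "a \<in> D" by blast
    moreover have "c \<in> Col" using D st unfolding sig_dataset_def sig_atom_def by fastforce
    ultimately show "a \<in> T_gnn Col \<delta> N D" using Cst[of a s] Cst[of a t] by (auto simp: T_gnn_def)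
  qed
  show "T_gnn Col \<delta> N D \<subseteq> T_prog P D \<union> {a \<in> D. \<exists>c s t. a = EA c s t}"
  proof
    fix a assume "a \<in> T_gnn Col \<delta> N D"
    then consider "a \<in> D" "\<exists>c s t. a = EA c s t"
      | i v where "a = UA i (Cst v)" "v \<in> dconsts D" "i < \<delta>" "thr N \<le> lab Col N D (layers N) v i"
      unfolding T_gnn_def by blast
    then show "a \<in> T_prog P D \<union> {a \<in> D. \<exists>c s t. a = EA c s t}"
    proof cases
      case (2 i v)
      let ?x = "to_nat ([] :: (nat \<times> nat \<times> nat) list)"
      let ?r = "(unravel D (layers N) v [], UA i (Vr ?x))"
      have "rule_sig Col \<delta> ?r" by (rule rule_sig_unravel[OF 2(3)])
      moreover have "tree_like_rule (layers N) (card Col * delta_max N * capacity Col N) ?r"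
        unfolding tree_like_rule_def
        by (rule exI, rule exI, rule exI, rule conjI[OF refl conjI[OF tree_like_unravel df_bounded_unravel]])
      moreover have "captures Col \<delta> N ?r" by (rule captures_unravel[OF finD 2(3,4)])
      ultimately obtain r' where r': "r' \<in> P" "eq_upto_renaming ?r r'"
        using complete by meson
      have "a \<in> T_rule r' D"
        using T_rule_eq_upto_renaming[OF r'(2)] unravel_derives[OF finD 2(2)] unfolding 2(1) by (rule subsetD)
      then show ?thesis using r'(1) unfolding T_prog_def by blast
    qed blast
  qed
qed

end

theorem theorem4:
  fixes Col :: "'col set" and \<delta> :: nat and N :: "'col mgnn"
  assumes "finite Col"
    and "mono_maxsum_gnn Col \<delta> N"
  shows "(\<exists>P. is_PiN Col \<delta> N P) \<and>
         (\<forall>P. is_PiN Col \<delta> N P \<longrightarrow>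
            (\<forall>D. sig_dataset Col \<delta> D \<longrightarrow>
               T_gnn Col \<delta> N D = T_prog P D \<union> {a \<in> D. \<exists>c s t. a = EA c s t}))"
proof -
  interpret monotonic_gnn Col \<delta> N using assms by unfold_locales
  show ?thesis using is_PiN_exists T_gnn_eq_T_prog by blast
qed

end
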